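(* The initial value problem for the $q$-wave equation $$\left[\left(D_{\frac1q}^t\right)^2-c^2\left(D_q^x\right)^2\right]u(x,t)=0,\qquad u(x,0)=f(x),\qquad D_{\frac1q}^t u(x,0)=g(x),\qquad -\infty<x<\infty,$$ is solved in the D'Alembert form $$u(x,t)=\frac{f(x+ct)_q+f(x-ct)_q}{2}+\frac{1}{2c}\int_{(x-ct)_q}^{(x+ct)_q}g(x')\,d_qx',$$ where the Jackson integral is $$\int_{(x-ct)_q}^{(x+ct)_q}g(x')\,d_qx'=(1-q)(x+ct)\sum_{j=0}^\infty q^j g(q^j(x+ct))_q-(1-q)(x-ct)\sum_{j=0}^\infty q^j g(q^j(x-ct))_q.$$ If the initial velocity is zero, $g(x)=0$, the formula reduces to $$u(x,t)=\frac12\left(f(x+ct)_q+f(x-ct)_q\right).$$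
   Context: Here $x,t$ are real variables, $c$ is the constant speed, and $q$ is the deformation parameter. The $q$-derivatives are $$D_q^xu(x,t)=\frac{u(qx,t)-u(x,t)}{(q-1)x},\qquad D_{\frac1q}^tu(x,t)=\frac{u(x,\frac tq)-u(x,t)}{(\frac1q-1)t},$$ and $D_{\frac1q}^tu(x,0)$ denotes $D_{\frac1q}^tu(x,t)$ at $t=0$. The $q$-binomials are $(x\pm ct)_q^n=(x\pm ct)(x\pm qct)\cdots(x\pm q^{n-1}ct)$, with $(x\pm ct)_q^0=1$ and, for negative exponents, $(x\pm ct)_q^{-n}=\frac{1}{(x\pm q^{-1}ct)(x\pm q^{-2}ct)\cdots(x\pm q^{-n}ct)}$, $n\ge1$. For a function with Laurent expansion $F(x)=\sum_{n=-\infty}^{\infty}a_nx^n$, the corresponding $q$-traveling waves are $F(x\pm ct)_q=\sum_{n=-\infty}^{\infty}a_n(x\pm ct)_q^n$; accordingly $F(q^j(x\pm ct))_q=\sum_{n=-\infty}^{\infty}a_nq^{jn}(x\pm ct)_q^n$.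
   Formalization: Assumes 0<|q|<1, Laurent series valid on the whole line (less 0) and a convergent Jackson integral of g; (x±ct)g(q^j(x±ct))_q means the q-wave of x g(q^j x), as the plain product fails for g(x)=x; the equation is for t≠0 off poles, the initial velocity a limit. *)

theory Defs
  imports "HOL-Analysis.Analysis"
begin

text \<open>
  The difference quotient has no value at \<open>y = 0\<close>; there the \<open>q\<close>-derivative is its limit.
\<close>

definition q_quotient :: "real \<Rightarrow> (real \<Rightarrow> real) \<Rightarrow> real \<Rightarrow> real" where
  "q_quotient q h y = (h (q * y) - h y) / ((q - 1) * y)"

definition q_deriv :: "real \<Rightarrow> (real \<Rightarrow> real) \<Rightarrow> real \<Rightarrow> real" where
  "q_deriv q h y = (if y = 0 then Lim (at 0) (q_quotient q h) else q_quotient q h y)"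

definition Dx :: "real \<Rightarrow> (real \<Rightarrow> real \<Rightarrow> real) \<Rightarrow> real \<Rightarrow> real \<Rightarrow> real" where
  "Dx q u = (\<lambda>x t. q_deriv q (\<lambda>y. u y t) x)"

definition Dt :: "real \<Rightarrow> (real \<Rightarrow> real \<Rightarrow> real) \<Rightarrow> real \<Rightarrow> real \<Rightarrow> real" where
  "Dt q u = (\<lambda>x t. q_deriv q (\<lambda>s. u x s) t)"

text \<open>The \<open>q\<close>-binomial \<open>(x + y)\<^sub>q\<^sup>n\<close>; the waves use \<open>y = c t\<close> and \<open>y = - c t\<close>.\<close>

definition q_binom :: "real \<Rightarrow> real \<Rightarrow> real \<Rightarrow> int \<Rightarrow> real" where
  "q_binom q x y n =
     (if n \<ge> 0 then \<Prod>k<nat n. (x + q ^ k * y)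
      else 1 / (\<Prod>k=1..nat (- n). (x + y / q ^ k)))"

text \<open>
  A Laurent series is given by its coefficients, and represents the function on the whole
  real line; the origin is left out when negative powers occur.
\<close>

definition has_laurent :: "(real \<Rightarrow> real) \<Rightarrow> (int \<Rightarrow> real) \<Rightarrow> bool" where
  "has_laurent F a \<longleftrightarrow>
     (\<forall>x. x \<noteq> 0 \<or> (\<forall>n<0. a n = 0) \<longrightarrow> ((\<lambda>n. a n * x powi n) has_sum F x) UNIV)"

text \<open>\<open>q_wave q a x y\<close> is \<open>F(x + y)\<^sub>q\<close> for the function \<open>F\<close> with coefficients \<open>a\<close>.\<close>

definition q_wave :: "real \<Rightarrow> (int \<Rightarrow> real) \<Rightarrow> real \<Rightarrow> real \<Rightarrow> real" where
  "q_wave q a x y = (\<Sum>\<^sub>\<infinity>n. a n * q_binom q x y n)"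

text \<open>Coefficients of \<open>F (s x)\<close> and of \<open>x F(x)\<close>.\<close>

definition scale_coeffs :: "real \<Rightarrow> (int \<Rightarrow> real) \<Rightarrow> int \<Rightarrow> real" where
  "scale_coeffs s a = (\<lambda>n. a n * s powi n)"

definition times_x_coeffs :: "(int \<Rightarrow> real) \<Rightarrow> int \<Rightarrow> real" where
  "times_x_coeffs a = (\<lambda>n. a (n - 1))"

text \<open>
  The Jackson integral of \<open>g\<close> from \<open>0\<close> to \<open>(x + y)\<^sub>q\<close>, i.e.
  \<open>(1 - q) (x + y) (\<Sum>j. q^j g(q^j (x + y))\<^sub>q)\<close>, with \<open>b\<close> the coefficients of \<open>g\<close>.
  The product \<open>(x + y) g(q^j (x + y))\<^sub>q\<close> is the \<open>q\<close>-traveling wave of the function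
  \<open>x g(q^j x)\<close>, so \<open>(x + y)\<close> times \<open>(x + y)\<^sub>q\<^sup>n\<close> is \<open>(x + y)\<^sub>q\<^sup>n\<^sup>+\<^sup>1\<close>.  It cannot be
  the product of real numbers: \<open>g(x) = x\<close> would then give \<open>u(x,t) = 2 x t / (1 + q)\<close>, whose
  initial velocity is not \<open>g\<close>.
\<close>

definition jackson_term :: "real \<Rightarrow> (int \<Rightarrow> real) \<Rightarrow> nat \<Rightarrow> int \<Rightarrow> real" where
  "jackson_term q b j = times_x_coeffs (scale_coeffs (q ^ j) b)"

definition jackson_to :: "real \<Rightarrow> (int \<Rightarrow> real) \<Rightarrow> real \<Rightarrow> real \<Rightarrow> real" where
  "jackson_to q b x y = (1 - q) * (\<Sum>j. q ^ j * q_wave q (jackson_term q b j) x y)"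

text \<open>
  Existence of the Jackson integrals of the monomials of \<open>g\<close>.  For \<open>\<bar>q\<bar> < 1\<close> this leaves
  the powers \<open>n \<ge> 0\<close>: the Jackson integral of \<open>x\<^sup>n\<close> diverges for all \<open>n < 0\<close>.
\<close>

definition jackson_convergent :: "real \<Rightarrow> (int \<Rightarrow> real) \<Rightarrow> bool" where
  "jackson_convergent q b \<longleftrightarrow>
     (\<forall>n. b n \<noteq> 0 \<longrightarrow> (\<forall>x. x \<noteq> 0 \<longrightarrow> summable (\<lambda>j. q ^ j * (q ^ j * x) powi n)))"

text \<open>
  The linear factors in the denominators of the \<open>q\<close>-binomials occurring in
  \<open>F(x + c t)\<^sub>q\<close> and \<open>F(x - c t)\<^sub>q\<close>; these waves are defined where no factor vanishes.
\<close>

definition q_denoms :: "real \<Rightarrow> real \<Rightarrow> (int \<Rightarrow> real) \<Rightarrow> real \<Rightarrow> real \<Rightarrow> real set" where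
  "q_denoms q c a x t =
     {x + \<sigma> * (c * t) / q ^ k | \<sigma> k. \<sigma> \<in> {1, -1} \<and> (\<exists>n<0. a n \<noteq> 0 \<and> k \<in> {1..nat (- n)})}"

definition wave_domain :: "real \<Rightarrow> real \<Rightarrow> (int \<Rightarrow> real) \<Rightarrow> (real \<times> real) set" where
  "wave_domain q c a = {(x, t). 0 \<notin> q_denoms q c a x t}"

text \<open>
  The times at which the factors stay away from \<open>0\<close>.  If \<open>F\<close> has infinitely many negative
  powers, the poles \<open>t = \<plusminus> q^k x / c\<close> of the waves accumulate at \<open>t = 0\<close>, so limits
  for \<open>t\<close> tending to \<open>0\<close> have to be taken within such a set.  If \<open>F\<close> has finitely many,
  the set contains a neighbourhood of \<open>t = 0\<close> as soon as \<open>\<delta> < \<bar>x\<bar>\<close>, and if it has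
  none, the set is the whole line.
\<close>

definition times_off_poles ::
    "real \<Rightarrow> real \<Rightarrow> (int \<Rightarrow> real) \<Rightarrow> real \<Rightarrow> real \<Rightarrow> real set" where
  "times_off_poles q c a \<delta> x = {t. \<forall>d \<in> q_denoms q c a x t. \<delta> \<le> \<bar>d\<bar>}"

end

theory Submission
  imports Defs
begin

text \<open>
  The \<open>q\<close>-binomials behave under both \<open>q\<close>-derivatives like powers of \<open>x + y\<close>: with the
  \<open>q\<close>-number \<open>[n] = (q\<^sup>n - 1) / (q - 1)\<close>, the operator \<open>D\<^sub>q\<close> in \<open>x\<close> and the operator
  \<open>D\<^bsub>1/q\<^esub>\<close> in \<open>y\<close> both send \<open>(x + y)\<^sub>q\<^sup>n\<close> to \<open>[n] (x + y)\<^sub>q\<^sup>n\<^sup>-\<^sup>1\<close>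
  (\<open>q_binom_diff_right\<close>, \<open>q_binom_diff_left\<close>).  Summing over \<open>n\<close>, both derivatives of a wave
  \<open>F(x + y)\<^sub>q\<close> are the wave of the \<open>q\<close>-derivative of \<open>F\<close> (\<open>q_wave_diff_right\<close>,
  \<open>q_wave_diff_left\<close>), and with \<open>y = \<plusminus> c t\<close> the wave equation follows as in the classical case.

  The Jackson integral of \<open>g\<close> from \<open>0\<close> to \<open>(x + y)\<^sub>q\<close> is a telescoping sum for the wave of the
  \<open>q\<close>-antiderivative \<open>G\<close> of \<open>g\<close> (\<open>jackson_sums\<close>).  Its existence excludes negative powers
  of \<open>x\<close> from \<open>g\<close>, so \<open>G\<close> is an entire series.  Thus \<open>u\<close> is a D'Alembert combination of the
  waves of \<open>f\<close> and \<open>G\<close>, and its initial velocity is the \<open>q\<close>-derivative of \<open>G\<close>, that is \<open>g\<close>.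

  The analysis rests on one estimate.  If all linear factors of the denominators have modulus
  at least \<open>\<delta>\<close> and \<open>\<bar>x\<bar> + \<bar>y\<bar> \<le> R\<close>, the terms of a wave are bounded by \<open>\<bar>a\<^sub>n\<bar> (R\<^sup>n + \<delta>\<^sup>n)\<close>
  (\<open>abs_wave_term_le\<close>), which is summable because the Laurent series converges at \<open>R\<close> and at
  \<open>\<delta>\<close>.  So waves converge where no denominator vanishes, and they are continuous along sets on
  which the factors stay away from \<open>0\<close> (\<open>tendsto_q_wave\<close>).  The continuity gives the second
  \<open>x\<close>-derivative at \<open>x = 0\<close>, where it is a limit, and the initial velocity as \<open>t\<close> tends to \<open>0\<close>.
\<close>

section \<open>Recursions for the \<open>q\<close>-binomials\<close>

definition q_number :: "real \<Rightarrow> int \<Rightarrow> real" where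
  "q_number q n = (q powi n - 1) / (q - 1)"

lemma q_binom_of_nat: "q_binom q x y (int m) = (\<Prod>k<m. x + q ^ k * y)"
  by (simp add: q_binom_def)

lemma q_binom_minus_of_nat: "q_binom q x y (- int m) = 1 / (\<Prod>k=1..m. x + y / q ^ k)"
  by (cases "m = 0") (simp_all add: q_binom_def)

lemma q_binom_zero_right: "q_binom q x 0 n = x powi n"
proof (cases n rule: int_cases2)
  case (nonneg m)
  then show ?thesis by (simp add: q_binom_of_nat)
next
  case (nonpos m)
  then show ?thesis
    unfolding nonpos q_binom_minus_of_nat by (simp add: power_int_minus inverse_eq_divide)
qed

text \<open>
  Replacing \<open>y\<close> by \<open>y / q\<close> shifts the product by one place, so \<open>(x + y / q)\<^sub>q\<^sup>n\<close> and
  \<open>(x + y)\<^sub>q\<^sup>n\<close> both contain \<open>(x + y)\<^sub>q\<^sup>n\<^sup>-\<^sup>1\<close>, the first with an extra factor in front and the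
  second with one at the end.  For \<open>n \<le> 0\<close> this cancels a factor of the denominator against
  itself, which is right only if that factor does not vanish.
\<close>

lemma q_binom_front_factor:
  assumes "q \<noteq> 0" and "n \<le> 0 \<Longrightarrow> x + y / q \<noteq> 0"
  shows "q_binom q x (y / q) n = (x + y / q) * q_binom q x y (n - 1)"
proof (cases "n \<le> 0")
  case True
  define m where "m = nat (- n)"
  have n: "n = - int m" and n1: "n - 1 = - int (Suc m)"
    using True by (simp_all add: m_def)
  have "(\<Prod>k=1..Suc m. x + y / q ^ k) = (x + y / q) * (\<Prod>k=1..m. x + y / q ^ Suc k)"
    unfolding One_nat_def prod.atLeast1_atMost_eq prod.lessThan_Suc_shift by simp
  moreover have "(\<Prod>k=1..m. x + y / q / q ^ k) = (\<Prod>k=1..m. x + y / q ^ Suc k)"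
    by simp
  ultimately show ?thesis
    unfolding n1 unfolding n q_binom_minus_of_nat using assms(2)[OF True] by simp
next
  case False
  define m where "m = nat (n - 1)"
  have n: "n = int (Suc m)" and n1: "n - 1 = int m"
    using False by (simp_all add: m_def)
  show ?thesis
    unfolding n1 unfolding n q_binom_of_nat prod.lessThan_Suc_shift using assms(1)
    by (simp add: mult.commute)
qed

lemma q_binom_back_factor:
  assumes "q \<noteq> 0" and "n \<le> 0 \<Longrightarrow> x + y / q ^ nat (1 - n) \<noteq> 0"
  shows "q_binom q x y n = (x + q powi (n - 1) * y) * q_binom q x y (n - 1)"
proof (cases "n \<le> 0")
  case True
  define m where "m = nat (- n)"
  have n: "n = - int m" and n1: "n - 1 = - int (Suc m)" and k: "nat (1 - n) = Suc m"
    using True by (simp_all add: m_def)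
  have "(\<Prod>k=1..Suc m. x + y / q ^ k) = (\<Prod>k=1..m. x + y / q ^ k) * (x + y / q ^ Suc m)"
    by simp
  moreover have "q powi (- int (Suc m)) * y = y / q ^ Suc m"
    by (simp only: power_int_minus power_int_of_nat) (simp add: divide_simps)
  ultimately show ?thesis
    using assms(2)[OF True] unfolding k unfolding n1 unfolding n q_binom_minus_of_nat by simp
next
  case False
  define m where "m = nat (n - 1)"
  have n: "n = int (Suc m)" and n1: "n - 1 = int m"
    using False by (simp_all add: m_def)
  show ?thesis
    unfolding n1 unfolding n q_binom_of_nat by (simp add: mult.commute)
qed

lemma q_binom_scale_left:
  assumes "q \<noteq> 0"
  shows "q_binom q (q * x) y n = q powi n * q_binom q x (y / q) n"
proof (cases n rule: int_cases2)
  case (nonneg m)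
  have "q * x + q ^ k * y = q * (x + q ^ k * (y / q))" for k
    using assms by (simp add: field_simps)
  then show ?thesis
    unfolding nonneg q_binom_of_nat by (simp add: prod.distrib)
next
  case (nonpos m)
  have "q * x + y / q ^ k = q * (x + y / q / q ^ k)" for k
    using assms by (simp add: field_simps)
  then show ?thesis
    unfolding nonpos q_binom_minus_of_nat
    by (simp add: prod.distrib power_int_minus inverse_eq_divide)
qed

text \<open>
  The front and the back factor differ by a multiple of \<open>y\<close> here, and of \<open>x\<close> in the next
  lemma, with the same \<open>q\<close>-number.  That the two \<open>q\<close>-derivatives of a \<open>q\<close>-binomial agree is
  the reason why a wave equation holds.
\<close>

lemma q_binom_diff_right:
  assumes "q \<noteq> 0" "q \<noteq> 1" and "\<And>k. n < 0 \<Longrightarrow> k \<in> {1..nat (1 - n)} \<Longrightarrow> x + y / q ^ k \<noteq> 0"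
  shows "q_binom q x (y / q) n - q_binom q x y n
       = (1 / q - 1) * y * (q_number q n * q_binom q x y (n - 1))"
proof (cases "n = 0")
  case True
  then show ?thesis by (simp add: q_number_def q_binom_def)
next
  case False
  have f: "q_binom q x (y / q) n = (x + y / q) * q_binom q x y (n - 1)"
    using False assms(1) assms(3)[of 1] by (intro q_binom_front_factor) auto
  have g: "q_binom q x y n = (x + q powi (n - 1) * y) * q_binom q x y (n - 1)"
    using False assms(1) assms(3)[of "nat (1 - n)"] by (intro q_binom_back_factor) auto
  show ?thesis
    unfolding f unfolding g using assms
    by (simp add: q_number_def power_int_diff field_simps)
qed

lemma q_binom_diff_left:
  assumes "q \<noteq> 0" "q \<noteq> 1" and "\<And>k. n < 0 \<Longrightarrow> k \<in> {1..nat (1 - n)} \<Longrightarrow> x + y / q ^ k \<noteq> 0"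
  shows "q_binom q (q * x) y n - q_binom q x y n
       = (q - 1) * x * (q_number q n * q_binom q x y (n - 1))"
proof (cases "n = 0")
  case True
  then show ?thesis by (simp add: q_number_def q_binom_def)
next
  case False
  have f: "q_binom q x (y / q) n = (x + y / q) * q_binom q x y (n - 1)"
    using False assms(1) assms(3)[of 1] by (intro q_binom_front_factor) auto
  have g: "q_binom q x y n = (x + q powi (n - 1) * y) * q_binom q x y (n - 1)"
    using False assms(1) assms(3)[of "nat (1 - n)"] by (intro q_binom_back_factor) auto
  show ?thesis
    unfolding q_binom_scale_left[OF assms(1)] f unfolding g using assms
    by (simp add: q_number_def power_int_diff field_simps)
qed

section \<open>Coefficients of Laurent series on the punctured line\<close>

definition abs_laurent :: "(int \<Rightarrow> real) \<Rightarrow> bool" where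
  "abs_laurent e \<longleftrightarrow> (\<forall>r>0. (\<lambda>n. \<bar>e n\<bar> * r powi n) summable_on UNIV)"

lemma abs_laurentD: "abs_laurent e \<Longrightarrow> r > 0 \<Longrightarrow> (\<lambda>n. \<bar>e n\<bar> * r powi n) summable_on UNIV"
  by (simp add: abs_laurent_def)

lemma has_laurent_imp_abs_laurent:
  assumes "has_laurent F e"
  shows "abs_laurent e"
  unfolding abs_laurent_def
proof (intro allI impI)
  fix r :: real assume r: "r > 0"
  then have "((\<lambda>n. e n * r powi n) has_sum F r) UNIV"
    using assms by (simp add: has_laurent_def)
  then have "(\<lambda>n. e n * r powi n) summable_on UNIV"
    by (rule has_sum_imp_summable)
  then have "(\<lambda>n. norm (e n * r powi n)) summable_on UNIV"
    by (rule iffD1[OF summable_on_iff_abs_summable_on_real])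
  then show "(\<lambda>n. \<bar>e n\<bar> * r powi n) summable_on UNIV"
    using r by (simp add: abs_mult)
qed

lemma abs_laurent_mult_le:
  assumes "abs_laurent e" and "\<And>n. \<bar>d n\<bar> \<le> C * \<bar>e n\<bar>"
  shows "abs_laurent d"
  unfolding abs_laurent_def
proof (intro allI impI)
  fix r :: real assume r: "r > 0"
  have "(\<lambda>n. C * (\<bar>e n\<bar> * r powi n)) summable_on UNIV"
    by (intro summable_on_cmult_right abs_laurentD assms r)
  then show "(\<lambda>n. \<bar>d n\<bar> * r powi n) summable_on UNIV"
  proof (rule summable_on_comparison_test)
    show "\<bar>d n\<bar> * r powi n \<le> C * (\<bar>e n\<bar> * r powi n)" for n
      unfolding mult.assoc[symmetric] using r assms(2)[of n] by (intro mult_right_mono) auto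
  qed (use r in auto)
qed

text \<open>
  Convergence for every radius survives dilations; a factor that is exponential in \<open>n\<close>, such
  as a \<open>q\<close>-number, is therefore harmless.
\<close>

lemma abs_laurent_scale:
  assumes "abs_laurent e" and "s \<noteq> 0"
  shows "abs_laurent (scale_coeffs s e)"
  unfolding abs_laurent_def
proof (intro allI impI)
  fix r :: real assume r: "r > 0"
  have "(\<lambda>n. \<bar>e n\<bar> * (\<bar>s\<bar> * r) powi n) summable_on UNIV"
    using assms(2) r by (intro abs_laurentD[OF assms(1)]) simp
  then show "(\<lambda>n. \<bar>scale_coeffs s e n\<bar> * r powi n) summable_on UNIV"
    by (simp add: scale_coeffs_def abs_mult power_int_mult_distrib power_int_abs mult.assoc)
qed

lemma abs_laurent_shift:
  assumes "abs_laurent e"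
  shows "abs_laurent (\<lambda>n. e (n + k))"
  unfolding abs_laurent_def
proof (intro allI impI)
  fix r :: real assume r: "r > 0"
  have bij: "bij_betw (\<lambda>n. n + k) UNIV (UNIV :: int set)"
    by (rule bij_betwI[where g = "\<lambda>n. n - k"]) auto
  have "(\<lambda>n. \<bar>e (n + k)\<bar> * r powi (n + k)) summable_on UNIV"
    using summable_on_reindex_bij_betw[OF bij, of "\<lambda>n. \<bar>e n\<bar> * r powi n"] abs_laurentD[OF assms r]
    by simp
  then have "(\<lambda>n. \<bar>e (n + k)\<bar> * r powi (n + k) * r powi (- k)) summable_on UNIV"
    by (rule summable_on_cmult_left)
  moreover have "\<bar>e (n + k)\<bar> * r powi (n + k) * r powi (- k) = \<bar>e (n + k)\<bar> * r powi n" for n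
    using r power_int_add[of r "n + k" "- k"] by (simp add: mult.assoc)
  ultimately show "(\<lambda>n. \<bar>e (n + k)\<bar> * r powi n) summable_on UNIV"
    by simp
qed

lemma abs_laurent_add:
  assumes "abs_laurent d" "abs_laurent e"
  shows "abs_laurent (\<lambda>n. d n + e n)"
  unfolding abs_laurent_def
proof (intro allI impI)
  fix r :: real assume r: "r > 0"
  have "(\<lambda>n. \<bar>d n\<bar> * r powi n + \<bar>e n\<bar> * r powi n) summable_on UNIV"
    by (intro summable_on_add abs_laurentD assms r)
  then show "(\<lambda>n. \<bar>d n + e n\<bar> * r powi n) summable_on UNIV"
  proof (rule summable_on_comparison_test)
    show "\<bar>d n + e n\<bar> * r powi n \<le> \<bar>d n\<bar> * r powi n + \<bar>e n\<bar> * r powi n" for n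
      unfolding distrib_right[symmetric] using r by (intro mult_right_mono abs_triangle_ineq) auto
  qed (use r in auto)
qed

definition deriv_coeffs :: "real \<Rightarrow> (int \<Rightarrow> real) \<Rightarrow> int \<Rightarrow> real" where
  "deriv_coeffs q e = (\<lambda>n. e (n + 1) * q_number q (n + 1))"

lemma abs_laurent_deriv:
  assumes "abs_laurent e" and "q \<noteq> 0"
  shows "abs_laurent (deriv_coeffs q e)"
proof -
  have "abs_laurent (\<lambda>n. scale_coeffs q e n + (- e n))"
    by (rule abs_laurent_add[OF abs_laurent_scale[OF assms] abs_laurent_mult_le[where C = 1, OF assms(1)]])
       simp
  then have "abs_laurent (\<lambda>n. e n * q_number q n)"
  proof (rule abs_laurent_mult_le[where C = "1 / \<bar>q - 1\<bar>"])
    fix n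
    have "e n * q_number q n = (scale_coeffs q e n + (- e n)) / (q - 1)"
      by (simp add: scale_coeffs_def q_number_def right_diff_distrib)
    then show "\<bar>e n * q_number q n\<bar> \<le> 1 / \<bar>q - 1\<bar> * \<bar>scale_coeffs q e n + - e n\<bar>"
      by (simp only: abs_divide) simp
  qed
  from abs_laurent_shift[OF this, of 1] show ?thesis
    by (simp add: deriv_coeffs_def)
qed

section \<open>Factors bounded away from zero\<close>

text \<open>
  Only the factors that occur in a denominator of a nonzero term are constrained, so that a
  series with finitely many negative powers asks for finitely many of them.
\<close>

definition factors_ge :: "real \<Rightarrow> real \<Rightarrow> (int \<Rightarrow> real) \<Rightarrow> real \<Rightarrow> real \<Rightarrow> bool" where
  "factors_ge q \<delta> e x y \<longleftrightarrow> (\<forall>n<0. e n \<noteq> 0 \<longrightarrow> (\<forall>k\<in>{1..nat (- n)}. \<delta> \<le> \<bar>x + y / q ^ k\<bar>))"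

lemma factors_ge_trivial: "(\<And>n. n < 0 \<Longrightarrow> e n = 0) \<Longrightarrow> factors_ge q \<delta> e x y"
  by (auto simp: factors_ge_def)

lemma q_number_nonzero:
  assumes "q \<noteq> 0" "\<bar>q\<bar> < 1" "n \<noteq> 0"
  shows "q_number q n \<noteq> 0"
proof -
  have *: "q ^ m \<noteq> 1" if "m > 0" for m :: nat
  proof
    assume "q ^ m = 1"
    then have "\<bar>q\<bar> ^ m = 1" by (simp flip: power_abs)
    moreover have "\<bar>q\<bar> ^ m < 1" using assms(2) that by (simp add: power_less_one_iff)
    ultimately show False by simp
  qed
  have "q powi n \<noteq> 1"
  proof (cases n rule: int_cases2)
    case (nonneg m)
    then show ?thesis using assms(3) *[of m] by simp
  next
    case (nonpos m)
    then show ?thesis using assms(3) *[of m] by (simp add: power_int_minus)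
  qed
  then show ?thesis using assms(2) by (auto simp: q_number_def)
qed

lemma factors_ge_derivD:
  assumes "factors_ge q \<delta> (deriv_coeffs q e) x y" "q \<noteq> 0" "\<bar>q\<bar> < 1"
    and "n < 0" "e n \<noteq> 0" "k \<in> {1..nat (1 - n)}"
  shows "\<delta> \<le> \<bar>x + y / q ^ k\<bar>"
proof -
  have "deriv_coeffs q e (n - 1) \<noteq> 0"
    using assms by (simp add: deriv_coeffs_def q_number_nonzero)
  moreover have "n - 1 < 0" using assms by simp
  ultimately show ?thesis
    using assms(1,6) unfolding factors_ge_def by (metis minus_diff_eq)
qed

text \<open>
  The derivative has no term with \<open>x\<^sup>-\<^sup>1\<close>, since the \<open>q\<close>-number of \<open>0\<close> vanishes; every negative
  power in it comes from a negative power of the original series.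
\<close>

lemma factors_ge_derivI:
  assumes "\<And>n k. n < 0 \<Longrightarrow> e n \<noteq> 0 \<Longrightarrow> k \<in> {1..nat (1 - n)} \<Longrightarrow> \<delta> \<le> \<bar>x + y / q ^ k\<bar>"
  shows "factors_ge q \<delta> (deriv_coeffs q e) x y"
  unfolding factors_ge_def
proof (intro allI impI ballI)
  fix n k assume n: "n < 0" "deriv_coeffs q e n \<noteq> 0" and k: "k \<in> {1..nat (- n)}"
  then have "e (n + 1) \<noteq> 0" "q_number q (n + 1) \<noteq> 0"
    by (auto simp: deriv_coeffs_def)
  moreover from this(2) have "n + 1 \<noteq> 0"
    by (auto simp: q_number_def)
  ultimately show "\<delta> \<le> \<bar>x + y / q ^ k\<bar>"
    using assms[of "n + 1" k] n(1) k by auto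
qed

lemma factors_ge_of_deriv:
  assumes "factors_ge q \<delta> (deriv_coeffs q e) x y" "q \<noteq> 0" "\<bar>q\<bar> < 1"
  shows "factors_ge q \<delta> e x y" and "factors_ge q \<delta> e x (y / q)"
    and "factors_ge q (\<bar>q\<bar> * \<delta>) e (q * x) y"
proof -
  note D = factors_ge_derivD[OF assms]
  show "factors_ge q \<delta> e x y"
    using D by (auto simp: factors_ge_def)
  show sh: "factors_ge q \<delta> e x (y / q)"
    unfolding factors_ge_def
  proof (intro allI impI ballI)
    fix n k assume "n < 0" "e n \<noteq> 0" "k \<in> {1..nat (- n)}"
    then show "\<delta> \<le> \<bar>x + y / q / q ^ k\<bar>"
      using D[of n "Suc k"] by auto
  qed
  have "\<bar>q * x + y / q ^ k\<bar> = \<bar>q\<bar> * \<bar>x + y / q / q ^ k\<bar>" for k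
    using assms(2) by (simp add: field_simps flip: abs_mult)
  then show "factors_ge q (\<bar>q\<bar> * \<delta>) e (q * x) y"
    using sh by (auto simp: factors_ge_def intro!: mult_left_mono)
qed

section \<open>Convergence and continuity of \<open>q\<close>-traveling waves\<close>

lemma abs_q_binom_le:
  assumes "\<bar>q\<bar> \<le> 1" "\<delta> > 0" "R > 0" "\<bar>x\<bar> + \<bar>y\<bar> \<le> R"
    and "\<And>k. n < 0 \<Longrightarrow> k \<in> {1..nat (- n)} \<Longrightarrow> \<delta> \<le> \<bar>x + y / q ^ k\<bar>"
  shows "\<bar>q_binom q x y n\<bar> \<le> R powi n + \<delta> powi n"
proof (cases "n < 0")
  case True
  define m where "m = nat (- n)"
  have n: "n = - int m" using True by (simp add: m_def)
  have "\<delta> ^ m = (\<Prod>k=1..m. \<delta>)" by simp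
  also have "\<dots> \<le> (\<Prod>k=1..m. \<bar>x + y / q ^ k\<bar>)"
    using assms(2) assms(5)[OF True] by (intro prod_mono) (auto simp: m_def)
  finally have le: "\<delta> ^ m \<le> (\<Prod>k=1..m. \<bar>x + y / q ^ k\<bar>)" .
  moreover have "0 < \<delta> ^ m" using assms(2) by simp
  ultimately have "1 / (\<Prod>k=1..m. \<bar>x + y / q ^ k\<bar>) \<le> 1 / \<delta> ^ m"
    by (rule frac_le[OF zero_le_one order_refl, rotated])
  then have "\<bar>q_binom q x y n\<bar> \<le> 1 / \<delta> ^ m"
    unfolding n q_binom_minus_of_nat abs_divide abs_prod abs_one .
  also have "\<dots> = \<delta> powi n"
    by (simp add: n power_int_minus inverse_eq_divide)
  finally show ?thesis using zero_le_power_int[of R n] assms(3) by linarith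
next
  case False
  define m where "m = nat n"
  have n: "n = int m" using False by (simp add: m_def)
  have "\<bar>x + q ^ k * y\<bar> \<le> R" for k
  proof -
    have "\<bar>q ^ k * y\<bar> \<le> \<bar>y\<bar>"
      using assms(1) by (simp add: abs_mult power_abs mult_left_le_one_le power_le_one)
    then show ?thesis using assms(4) by linarith
  qed
  then have "(\<Prod>k<m. \<bar>x + q ^ k * y\<bar>) \<le> (\<Prod>k<m. R)"
    by (intro prod_mono) auto
  then have "\<bar>q_binom q x y n\<bar> \<le> R powi n"
    unfolding n q_binom_of_nat abs_prod by simp
  then show ?thesis using zero_le_power_int[of \<delta> n] assms(2) by linarith
qed

text \<open>
  The majorant consists of the terms of the given Laurent series at the two points \<open>R\<close> and \<open>\<delta>\<close>
  and is independent of \<open>x\<close> and \<open>y\<close>.  It serves for convergence and for limits.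
\<close>

lemma abs_wave_term_le:
  assumes "factors_ge q \<delta> e x y" "\<bar>q\<bar> \<le> 1" "\<delta> > 0" "R > 0" "\<bar>x\<bar> + \<bar>y\<bar> \<le> R"
  shows "\<bar>e n * q_binom q x y n\<bar> \<le> \<bar>e n\<bar> * R powi n + \<bar>e n\<bar> * \<delta> powi n"
proof (cases "e n = 0")
  case False
  then have "\<bar>q_binom q x y n\<bar> \<le> R powi n + \<delta> powi n"
    using assms by (intro abs_q_binom_le) (auto simp: factors_ge_def)
  then show ?thesis
    by (simp add: abs_mult mult_left_mono flip: distrib_left)
qed simp

lemma summable_on_wave:
  assumes "abs_laurent e" "factors_ge q \<delta> e x y" "\<bar>q\<bar> \<le> 1" "\<delta> > 0"
  shows "(\<lambda>n. e n * q_binom q x y n) summable_on UNIV"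
proof -
  \<comment> \<open>The summand \<open>1\<close> keeps \<open>R\<close> positive at the origin.\<close>
  define R where "R = \<bar>x\<bar> + \<bar>y\<bar> + 1"
  have R: "R > 0" "\<bar>x\<bar> + \<bar>y\<bar> \<le> R" by (simp_all add: R_def)
  have "(\<lambda>n. norm (e n * q_binom q x y n)) summable_on UNIV"
  proof (rule Infinite_Sum.abs_summable_on_comparison_test')
    show "(\<lambda>n. \<bar>e n\<bar> * R powi n + \<bar>e n\<bar> * \<delta> powi n) summable_on UNIV"
      by (intro summable_on_add abs_laurentD assms R)
    show "norm (e n * q_binom q x y n) \<le> \<bar>e n\<bar> * R powi n + \<bar>e n\<bar> * \<delta> powi n" for n
      using abs_wave_term_le[OF assms(2,3,4) R] by simp
  qed
  then show ?thesis
    by (rule iffD2[OF summable_on_iff_abs_summable_on_real])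
qed

text \<open>
  Tannery's theorem for unordered sums: the Weierstrass test makes the convergence of the
  finite partial sums uniform, and uniform limits may be interchanged with the limit along \<open>F\<close>.
\<close>

lemma tendsto_infsum_dominated:
  fixes f :: "'a \<Rightarrow> 'b \<Rightarrow> real"
  assumes lim: "\<And>n. (f n \<longlongrightarrow> g n) F"
    and bound: "\<forall>\<^sub>F p in F. \<forall>n. \<bar>f n p\<bar> \<le> M n"
    and M: "M summable_on UNIV"
  shows "((\<lambda>p. \<Sum>\<^sub>\<infinity>n. f n p) \<longlongrightarrow> (\<Sum>\<^sub>\<infinity>n. g n)) F"
proof (cases "F = bot")
  case False
  have "\<bar>g n\<bar> \<le> M n" for n
    using bound False by (intro tendsto_upperbound[OF tendsto_rabs[OF lim]]) (auto elim: eventually_mono)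
  then have "(\<lambda>n. norm (g n)) summable_on UNIV"
    using M by (intro Infinite_Sum.abs_summable_on_comparison_test'[where g = M]) auto
  then have g: "g summable_on UNIV"
    by (rule iffD2[OF summable_on_iff_abs_summable_on_real])
  show ?thesis
  proof (rule swap_uniform_limit')
    show "uniform_limit {p. \<forall>n. \<bar>f n p\<bar> \<le> M n} (\<lambda>N p. \<Sum>n\<in>N. f n p) (\<lambda>p. \<Sum>\<^sub>\<infinity>n. f n p)
            (finite_subsets_at_top UNIV)"
      by (rule Weierstrass_m_test_general[OF _ M]) auto
    show "(sum g \<longlongrightarrow> (\<Sum>\<^sub>\<infinity>n. g n)) (finite_subsets_at_top UNIV)"
      using has_sum_infsum[OF g] by (simp add: has_sum_def)
  qed (use lim bound in \<open>auto intro!: always_eventually tendsto_sum\<close>)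
qed simp

lemma tendsto_q_binom:
  assumes "q \<noteq> 0" "(X \<longlongrightarrow> x) F" "(Y \<longlongrightarrow> y) F"
    and "\<And>k. n < 0 \<Longrightarrow> k \<in> {1..nat (- n)} \<Longrightarrow> x + y / q ^ k \<noteq> 0"
  shows "((\<lambda>p. q_binom q (X p) (Y p) n) \<longlongrightarrow> q_binom q x y n) F"
proof (cases "n < 0")
  case True
  then show ?thesis
    using assms unfolding q_binom_def by (auto intro!: tendsto_intros)
next
  case False
  then show ?thesis
    using assms unfolding q_binom_def by (auto intro!: tendsto_intros)
qed

lemma tendsto_q_wave:
  assumes e: "abs_laurent e" and q: "q \<noteq> 0" "\<bar>q\<bar> \<le> 1" and \<delta>: "\<delta> > 0"
    and X: "(X \<longlongrightarrow> x) F" and Y: "(Y \<longlongrightarrow> y) F"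
    and ev: "\<forall>\<^sub>F p in F. factors_ge q \<delta> e (X p) (Y p)" and at: "factors_ge q \<delta> e x y"
  shows "((\<lambda>p. q_wave q e (X p) (Y p)) \<longlongrightarrow> q_wave q e x y) F"
  unfolding q_wave_def
proof (rule tendsto_infsum_dominated)
  define R where "R = \<bar>x\<bar> + \<bar>y\<bar> + 1"
  have R: "R > 0" by (simp add: R_def)
  show "(\<lambda>n. \<bar>e n\<bar> * R powi n + \<bar>e n\<bar> * \<delta> powi n) summable_on UNIV"
    by (intro summable_on_add abs_laurentD assms R)
  have "((\<lambda>p. \<bar>X p\<bar> + \<bar>Y p\<bar>) \<longlongrightarrow> \<bar>x\<bar> + \<bar>y\<bar>) F"
    by (intro tendsto_intros X Y)
  then have "\<forall>\<^sub>F p in F. \<bar>X p\<bar> + \<bar>Y p\<bar> < R"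
    by (rule order_tendstoD) (simp add: R_def)
  with ev show "\<forall>\<^sub>F p in F. \<forall>n. \<bar>e n * q_binom q (X p) (Y p) n\<bar>
                  \<le> \<bar>e n\<bar> * R powi n + \<bar>e n\<bar> * \<delta> powi n"
    by eventually_elim (intro allI abs_wave_term_le q \<delta> R, auto)
  show "((\<lambda>p. e n * q_binom q (X p) (Y p) n) \<longlongrightarrow> e n * q_binom q x y n) F" for n
  proof (cases "e n = 0")
    case False
    then have "x + y / q ^ k \<noteq> 0" if "n < 0" "k \<in> {1..nat (- n)}" for k
      using at \<delta> that unfolding factors_ge_def by fastforce
    then show ?thesis
      by (intro tendsto_mult tendsto_const tendsto_q_binom q X Y)
  qed simp
qed

section \<open>The two \<open>q\<close>-derivatives of a wave\<close>

lemma infsum_real_diff: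
  fixes f g :: "'a \<Rightarrow> real"
  assumes "f summable_on A" "g summable_on A"
  shows "(\<Sum>\<^sub>\<infinity>n\<in>A. f n - g n) = infsum f A - infsum g A"
  using infsum_add[OF assms(1), of "\<lambda>n. - g n"] assms(2)
  by (simp add: infsum_uminus summable_on_uminus)

lemma infsum_deriv_coeffs:
  "(\<Sum>\<^sub>\<infinity>n. e n * (q_number q n * q_binom q x y (n - 1))) = q_wave q (deriv_coeffs q e) x y"
proof -
  have bij: "bij_betw (\<lambda>n. n + 1) UNIV (UNIV :: int set)"
    by (rule bij_betwI[where g = "\<lambda>n. n - 1"]) auto
  show ?thesis
    using infsum_reindex_bij_betw[OF bij, of "\<lambda>n. e n * (q_number q n * q_binom q x y (n - 1))"]
    by (simp add: q_wave_def deriv_coeffs_def mult.assoc)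
qed

text \<open>
  Term by term, this and the next lemma are the two difference formulas for \<open>q\<close>-binomials.
  Both derivatives of \<open>F(x + y)\<^sub>q\<close> are the wave of the same function, the \<open>q\<close>-derivative of \<open>F\<close>.
\<close>

lemma q_wave_diff_right:
  assumes "abs_laurent e" "factors_ge q \<delta> (deriv_coeffs q e) x y" "q \<noteq> 0" "\<bar>q\<bar> < 1" "\<delta> > 0"
  shows "q_wave q e x (y / q) - q_wave q e x y = (1 / q - 1) * y * q_wave q (deriv_coeffs q e) x y"
proof -
  note F = factors_ge_of_deriv[OF assms(2-4)]
  have "q_wave q e x (y / q) - q_wave q e x y
      = (\<Sum>\<^sub>\<infinity>n. e n * q_binom q x (y / q) n - e n * q_binom q x y n)"
    unfolding q_wave_def using assms F
    by (intro infsum_real_diff [symmetric]) (auto intro: summable_on_wave)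
  also have "\<dots> = (\<Sum>\<^sub>\<infinity>n. (1 / q - 1) * y * (e n * (q_number q n * q_binom q x y (n - 1))))"
  proof (rule infsum_cong)
    fix n
    show "e n * q_binom q x (y / q) n - e n * q_binom q x y n
        = (1 / q - 1) * y * (e n * (q_number q n * q_binom q x y (n - 1)))"
    proof (cases "e n = 0")
      case False
      then have "x + y / q ^ k \<noteq> 0" if "n < 0" "k \<in> {1..nat (1 - n)}" for k
        using factors_ge_derivD[OF assms(2-4) that(1) False that(2)] assms(5) by auto
      then have D: "q_binom q x (y / q) n - q_binom q x y n
            = (1 / q - 1) * y * (q_number q n * q_binom q x y (n - 1))"
        using assms(3,4) by (intro q_binom_diff_right) auto
      show ?thesis
        unfolding right_diff_distrib[symmetric] D by (rule mult.left_commute)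
    qed simp
  qed
  also have "\<dots> = (1 / q - 1) * y * q_wave q (deriv_coeffs q e) x y"
    by (subst infsum_cmult_right') (simp only: infsum_deriv_coeffs)
  finally show ?thesis .
qed

lemma q_wave_diff_left:
  assumes "abs_laurent e" "factors_ge q \<delta> (deriv_coeffs q e) x y" "q \<noteq> 0" "\<bar>q\<bar> < 1" "\<delta> > 0"
  shows "q_wave q e (q * x) y - q_wave q e x y = (q - 1) * x * q_wave q (deriv_coeffs q e) x y"
proof -
  note F = factors_ge_of_deriv[OF assms(2-4)]
  have "\<bar>q\<bar> * \<delta> > 0" using assms by simp
  then have "q_wave q e (q * x) y - q_wave q e x y
      = (\<Sum>\<^sub>\<infinity>n. e n * q_binom q (q * x) y n - e n * q_binom q x y n)"
    unfolding q_wave_def using assms F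
    by (intro infsum_real_diff [symmetric]) (auto intro: summable_on_wave)
  also have "\<dots> = (\<Sum>\<^sub>\<infinity>n. (q - 1) * x * (e n * (q_number q n * q_binom q x y (n - 1))))"
  proof (rule infsum_cong)
    fix n
    show "e n * q_binom q (q * x) y n - e n * q_binom q x y n
        = (q - 1) * x * (e n * (q_number q n * q_binom q x y (n - 1)))"
    proof (cases "e n = 0")
      case False
      then have "x + y / q ^ k \<noteq> 0" if "n < 0" "k \<in> {1..nat (1 - n)}" for k
        using factors_ge_derivD[OF assms(2-4) that(1) False that(2)] assms(5) by auto
      then have D: "q_binom q (q * x) y n - q_binom q x y n
            = (q - 1) * x * (q_number q n * q_binom q x y (n - 1))"
        using assms(3,4) by (intro q_binom_diff_left) auto
      show ?thesis
        unfolding right_diff_distrib[symmetric] D by (rule mult.left_commute)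
    qed simp
  qed
  also have "\<dots> = (q - 1) * x * q_wave q (deriv_coeffs q e) x y"
    by (subst infsum_cmult_right') (simp only: infsum_deriv_coeffs)
  finally show ?thesis .
qed

section \<open>D'Alembert combinations of waves\<close>

lemma q_wave_cmult: "q_wave q (\<lambda>n. k * e n) x y = k * q_wave q e x y"
  unfolding q_wave_def mult.assoc by (rule infsum_cmult_right')

lemma q_wave_zero_right: "q_wave q e x 0 = (\<Sum>\<^sub>\<infinity>n. e n * x powi n)"
  by (simp add: q_wave_def q_binom_zero_right)

lemma deriv_coeffs_cmult: "deriv_coeffs q (\<lambda>n. k * e n) = (\<lambda>n. k * deriv_coeffs q e n)"
  by (simp add: deriv_coeffs_def mult.assoc)

lemma deriv_coeffs_no_principal_part:
  assumes "\<And>n. n < 0 \<Longrightarrow> e n = 0" "n < 0"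
  shows "deriv_coeffs q e n = 0"
  using assms(1)[of "n + 1"] assms(2) by (cases "n = -1") (auto simp: deriv_coeffs_def q_number_def)

lemma factors_ge_mono: "factors_ge q \<delta> e x y \<Longrightarrow> \<epsilon> \<le> \<delta> \<Longrightarrow> factors_ge q \<epsilon> e x y"
  by (fastforce simp: factors_ge_def)

lemma mem_q_denoms_iff:
  "d \<in> q_denoms q c e x t \<longleftrightarrow>
     (\<exists>n<0. e n \<noteq> 0 \<and> (\<exists>k\<in>{1..nat (- n)}. d = x + c * t / q ^ k \<or> d = x + - (c * t) / q ^ k))"
  (is "?L \<longleftrightarrow> ?R")
proof
  assume ?L
  then obtain \<sigma> k n where "d = x + \<sigma> * (c * t) / q ^ k" "\<sigma> = 1 \<or> \<sigma> = -1"
      "n < 0" "e n \<noteq> 0" "k \<in> {1..nat (- n)}"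
    unfolding q_denoms_def by blast
  then show ?R
    by (intro exI[of _ n] conjI bexI[of _ k]) auto
next
  assume ?R
  then obtain n k where "n < 0" "e n \<noteq> 0" "k \<in> {1..nat (- n)}"
      and "d = x + 1 * (c * t) / q ^ k \<or> d = x + (- 1) * (c * t) / q ^ k"
    by auto
  then show ?L unfolding q_denoms_def by blast
qed

lemma mem_times_off_poles_iff:
  "t \<in> times_off_poles q c e \<delta> x
     \<longleftrightarrow> factors_ge q \<delta> e x (c * t) \<and> factors_ge q \<delta> e x (- (c * t))"
  (is "?L \<longleftrightarrow> ?P \<and> ?M")
proof (intro iffI conjI)
  assume ?L
  then have far: "\<delta> \<le> \<bar>d\<bar>" if "d \<in> q_denoms q c e x t" for d
    using that by (simp add: times_off_poles_def)
  show ?P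
    unfolding factors_ge_def
    by (intro allI impI ballI far) (unfold mem_q_denoms_iff, blast)
  show ?M
    unfolding factors_ge_def
    by (intro allI impI ballI far) (unfold mem_q_denoms_iff, blast)
next
  assume PM: "?P \<and> ?M"
  show ?L
    unfolding times_off_poles_def mem_Collect_eq
  proof
    fix d assume "d \<in> q_denoms q c e x t"
    with PM show "\<delta> \<le> \<bar>d\<bar>"
      unfolding mem_q_denoms_iff factors_ge_def by auto
  qed
qed

lemma mem_wave_domain_iff:
  "(x, t) \<in> wave_domain q c e
     \<longleftrightarrow> (\<forall>n<0. e n \<noteq> 0 \<longrightarrow> (\<forall>k\<in>{1..nat (- n)}. x + c * t / q ^ k \<noteq> 0 \<and> x - c * t / q ^ k \<noteq> 0))"
  by (auto simp: wave_domain_def mem_q_denoms_iff)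

text \<open>
  With the \<open>q\<close>-antiderivative of \<open>g\<close> as \<open>e\<close> this is D'Alembert's formula.  The family is closed
  under both \<open>q\<close>-derivatives: in \<open>x\<close> both coefficient families are differentiated, while in \<open>t\<close>
  the sign of the speed exchanges the even and the odd part.
\<close>

definition dalembert ::
    "real \<Rightarrow> real \<Rightarrow> (int \<Rightarrow> real) \<Rightarrow> (int \<Rightarrow> real) \<Rightarrow> real \<Rightarrow> real \<Rightarrow> real" where
  "dalembert q c d e x t =
     (q_wave q d x (c * t) + q_wave q d x (- (c * t))) / 2
   + 1 / (2 * c) * (q_wave q e x (c * t) - q_wave q e x (- (c * t)))"

lemma dalembert_cmult: "dalembert q c (\<lambda>n. k * d n) (\<lambda>n. k * e n) x t = k * dalembert q c d e x t"
  unfolding dalembert_def q_wave_cmult by (simp add: algebra_simps)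

lemma Dt_dalembert:
  assumes "q \<noteq> 0" "\<bar>q\<bar> < 1" "c \<noteq> 0" "\<delta> > 0" "t \<noteq> 0" "abs_laurent d" "abs_laurent e"
    and "t \<in> times_off_poles q c (deriv_coeffs q d) \<delta> x"
    and "t \<in> times_off_poles q c (deriv_coeffs q e) \<delta> x"
  shows "Dt (1 / q) (dalembert q c d e) x t
       = dalembert q c (deriv_coeffs q e) (\<lambda>n. c\<^sup>2 * deriv_coeffs q d n) x t"
proof -
  define K where "K = 1 / q - 1"
  have K: "K \<noteq> 0" using assms(1,2) by (auto simp: K_def field_simps)
  have P: "q_wave q h x (c * (1 / q * t)) = q_wave q h x (c * t) + K * (c * t) * q_wave q (deriv_coeffs q h) x (c * t)"
    and M: "q_wave q h x (- (c * (1 / q * t))) = q_wave q h x (- (c * t)) - K * (c * t) * q_wave q (deriv_coeffs q h) x (- (c * t))"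
    if "abs_laurent h" "t \<in> times_off_poles q c (deriv_coeffs q h) \<delta> x" for h
    using q_wave_diff_right[OF that(1) _ assms(1,2,4), of x "c * t"]
      q_wave_diff_right[OF that(1) _ assms(1,2,4), of x "- (c * t)"] that(2)
    by (auto simp: mem_times_off_poles_iff K_def)
  note S = P[OF assms(6,8)] M[OF assms(6,8)] P[OF assms(7,9)] M[OF assms(7,9)]
  show ?thesis
    unfolding Dt_def q_deriv_def q_quotient_def dalembert_def S q_wave_cmult K_def[symmetric]
    using assms(3,5) K by (simp add: field_simps power2_eq_square)
qed

lemma Dx_dalembert:
  assumes "q \<noteq> 0" "\<bar>q\<bar> < 1" "\<delta> > 0" "x \<noteq> 0" "abs_laurent d" "abs_laurent e"
    and "t \<in> times_off_poles q c (deriv_coeffs q d) \<delta> x"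
    and "t \<in> times_off_poles q c (deriv_coeffs q e) \<delta> x"
  shows "Dx q (dalembert q c d e) x t
       = dalembert q c (deriv_coeffs q d) (deriv_coeffs q e) x t"
proof -
  define K where "K = q - 1"
  have K: "K \<noteq> 0" using assms(2) by (auto simp: K_def)
  have P: "q_wave q h (q * x) y = q_wave q h x y + K * x * q_wave q (deriv_coeffs q h) x y"
    if "abs_laurent h" "t \<in> times_off_poles q c (deriv_coeffs q h) \<delta> x" "y \<in> {c * t, - (c * t)}" for h y
    using q_wave_diff_left[OF that(1) _ assms(1,2,3), of x y] that(2,3)
    by (auto simp: mem_times_off_poles_iff K_def)
  note S = P[OF assms(5,7) insertI1] P[OF assms(5,7) insertI2[OF singletonI]]
    P[OF assms(6,8) insertI1] P[OF assms(6,8) insertI2[OF singletonI]]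
  have "dalembert q c d e (q * x) t - dalembert q c d e x t
      = K * x * dalembert q c (deriv_coeffs q d) (deriv_coeffs q e) x t"
    unfolding dalembert_def S by (simp add: algebra_simps add_divide_distrib diff_divide_distrib)
  then show ?thesis
    unfolding Dx_def q_deriv_def q_quotient_def K_def[symmetric] using assms(4) K by simp
qed

text \<open>
  Differentiating twice in \<open>t\<close> exchanges the two parts twice and leaves the factor \<open>c\<^sup>2\<close>.
\<close>

lemma Dt_Dt_dalembert:
  assumes "q \<noteq> 0" "\<bar>q\<bar> < 1" "c \<noteq> 0" "\<delta> > 0" "t \<noteq> 0" "abs_laurent d" "abs_laurent e"
    and d: "t \<in> times_off_poles q c (deriv_coeffs q (deriv_coeffs q d)) \<delta> x"
    and e: "t \<in> times_off_poles q c (deriv_coeffs q (deriv_coeffs q e)) \<delta> x"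
  shows "Dt (1 / q) (Dt (1 / q) (dalembert q c d e)) x t
       = c\<^sup>2 * dalembert q c (deriv_coeffs q (deriv_coeffs q d)) (deriv_coeffs q (deriv_coeffs q e)) x t"
proof -
  let ?D = "deriv_coeffs q"
  let ?v = "dalembert q c (?D e) (\<lambda>n. c\<^sup>2 * ?D d n)"
  have off: "s \<in> times_off_poles q c (?D h) \<delta> x"
    if "t \<in> times_off_poles q c (?D (?D h)) \<delta> x" "s \<in> {t, 1 / q * t}" for h s
    using that factors_ge_of_deriv(1,2)[OF _ assms(1,2), of \<delta> "?D h" x "c * t"]
      factors_ge_of_deriv(1,2)[OF _ assms(1,2), of \<delta> "?D h" x "- (c * t)"]
    by (auto simp: mem_times_off_poles_iff)
  have first: "Dt (1 / q) (dalembert q c d e) x s = ?v x s" if "s \<in> {t, 1 / q * t}" for s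
    using that assms(1,5) by (intro Dt_dalembert[OF assms(1-4) _ assms(6,7) off[OF d that] off[OF e that]]) auto
  have "Dt (1 / q) (Dt (1 / q) (dalembert q c d e)) x t = Dt (1 / q) ?v x t"
    using assms(5) first
    unfolding Dt_def[of "1 / q" "Dt _ _"] Dt_def[of "1 / q" ?v] q_deriv_def q_quotient_def by simp
  also have "\<dots> = dalembert q c (?D (\<lambda>n. c\<^sup>2 * ?D d n)) (\<lambda>n. c\<^sup>2 * ?D (?D e) n) x t"
  proof (rule Dt_dalembert[OF assms(1-5)])
    show "abs_laurent (\<lambda>n. c\<^sup>2 * ?D d n)"
      using abs_laurent_deriv[OF assms(6,1)]
      by (rule abs_laurent_mult_le[where C = "c\<^sup>2"]) (simp add: abs_mult)
    show "t \<in> times_off_poles q c (?D (\<lambda>n. c\<^sup>2 * ?D d n)) \<delta> x"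
      using d assms(3) by (simp add: deriv_coeffs_cmult mem_times_off_poles_iff factors_ge_def)
  qed (use e assms in \<open>auto intro: abs_laurent_deriv\<close>)
  also have "\<dots> = c\<^sup>2 * dalembert q c (?D (?D d)) (?D (?D e)) x t"
    by (simp only: deriv_coeffs_cmult dalembert_cmult)
  finally show ?thesis .
qed

text \<open>
  Stated for the quotient instead of the second derivative itself, because the value of the
  latter at \<open>x = 0\<close> is the limit of these quotients.
\<close>

lemma q_quotient_Dx_dalembert:
  assumes "q \<noteq> 0" "\<bar>q\<bar> < 1" "\<delta> > 0" "x \<noteq> 0" "abs_laurent d" "abs_laurent e"
    and d: "t \<in> times_off_poles q c (deriv_coeffs q (deriv_coeffs q d)) \<delta> x"
    and e: "t \<in> times_off_poles q c (deriv_coeffs q (deriv_coeffs q e)) \<delta> x"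
  shows "q_quotient q (\<lambda>y. Dx q (dalembert q c d e) y t) x
       = dalembert q c (deriv_coeffs q (deriv_coeffs q d)) (deriv_coeffs q (deriv_coeffs q e)) x t"
proof -
  let ?D = "deriv_coeffs q"
  let ?v = "dalembert q c (?D d) (?D e)"
  have le: "\<bar>q\<bar> * \<delta> \<le> \<delta>" "\<bar>q\<bar> * \<delta> > 0" using assms(1-3) by (simp_all add: mult_left_le_one_le)
  have off: "t \<in> times_off_poles q c (?D h) (\<bar>q\<bar> * \<delta>) z"
    if "t \<in> times_off_poles q c (?D (?D h)) \<delta> x" "z \<in> {x, q * x}" for h z
    using that factors_ge_of_deriv(1,3)[OF _ assms(1,2), of \<delta> "?D h" x "c * t"]
      factors_ge_of_deriv(1,3)[OF _ assms(1,2), of \<delta> "?D h" x "- (c * t)"] le(1)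
    by (auto simp: mem_times_off_poles_iff intro: factors_ge_mono)
  have first: "Dx q (dalembert q c d e) z t = ?v z t" if "z \<in> {x, q * x}" for z
    using that assms(1,4) by (intro Dx_dalembert[OF assms(1,2) le(2) _ assms(5,6) off[OF d that] off[OF e that]]) auto
  have "q_quotient q (\<lambda>y. Dx q (dalembert q c d e) y t) x = Dx q ?v x t"
    using assms(4) first unfolding Dx_def[of q ?v] q_deriv_def q_quotient_def by simp
  also have "\<dots> = dalembert q c (?D (?D d)) (?D (?D e)) x t"
    by (rule Dx_dalembert[OF assms(1-4) _ _ d e]) (intro abs_laurent_deriv assms)+
  finally show ?thesis .
qed

lemma tendsto_dalembert:
  assumes "abs_laurent d" "abs_laurent e" "q \<noteq> 0" "\<bar>q\<bar> \<le> 1" "\<delta> > 0"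
    and X: "(X \<longlongrightarrow> x) F" and T: "(T \<longlongrightarrow> t) F"
    and "\<forall>\<^sub>F p in F. T p \<in> times_off_poles q c d \<delta> (X p)" "t \<in> times_off_poles q c d \<delta> x"
    and "\<forall>\<^sub>F p in F. T p \<in> times_off_poles q c e \<delta> (X p)" "t \<in> times_off_poles q c e \<delta> x"
  shows "((\<lambda>p. dalembert q c d e (X p) (T p)) \<longlongrightarrow> dalembert q c d e x t) F"
proof -
  have W: "((\<lambda>p. q_wave q h (X p) (c * T p)) \<longlongrightarrow> q_wave q h x (c * t)) F"
          "((\<lambda>p. q_wave q h (X p) (- (c * T p))) \<longlongrightarrow> q_wave q h x (- (c * t))) F"
    if "abs_laurent h" "\<forall>\<^sub>F p in F. T p \<in> times_off_poles q c h \<delta> (X p)" "t \<in> times_off_poles q c h \<delta> x"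
    for h
    using that assms(3-5)
    by (auto intro!: tendsto_q_wave X T tendsto_intros simp: mem_times_off_poles_iff elim: eventually_mono)
  show ?thesis
    unfolding dalembert_def divide_inverse
    by (intro tendsto_add tendsto_mult tendsto_diff tendsto_const W assms)
qed

text \<open>
  The zeros in \<open>x\<close> of the factors are the numbers \<open>- y / q\<^sup>k\<close>, of modulus at least \<open>\<bar>y\<bar>\<close>.
\<close>

lemma factors_ge_near_axis:
  assumes "q \<noteq> 0" "\<bar>q\<bar> \<le> 1" "\<bar>x\<bar> \<le> \<bar>y\<bar> / 2"
  shows "factors_ge q (\<bar>y\<bar> / 2) e x y"
  unfolding factors_ge_def
proof (intro allI impI ballI)
  fix k :: nat
  have "\<bar>q\<bar> ^ k \<le> 1" "\<bar>q\<bar> ^ k > 0" using assms by (auto intro: power_le_one)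
  then have "\<bar>y\<bar> \<le> \<bar>y / q ^ k\<bar>"
    by (simp add: abs_divide power_abs pos_le_divide_eq mult_left_le)
  then show "\<bar>y\<bar> / 2 \<le> \<bar>x + y / q ^ k\<bar>" using assms(3) by linarith
qed

text \<open>
  The factors tend to infinity unless \<open>y = 0\<close>, when they are all equal to \<open>x\<close>.  So if none of
  them vanishes, they have a positive lower bound.
\<close>

lemma factors_ge_exists:
  assumes "\<bar>q\<bar> < 1" "q \<noteq> 0"
    and nz: "\<And>n k. n < 0 \<Longrightarrow> e n \<noteq> 0 \<Longrightarrow> k \<in> {1..nat (- n)} \<Longrightarrow> x + y / q ^ k \<noteq> 0"
  shows "\<exists>\<delta>>0. factors_ge q \<delta> e x y"
proof (cases "y = 0")
  case True
  show ?thesis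
  proof (cases "x = 0")
    case True
    with \<open>y = 0\<close> nz have "e n = 0" if "n < 0" for n
      using that nz[of n 1] by fastforce
    then show ?thesis by (intro exI[of _ 1] conjI factors_ge_trivial) auto
  next
    case False
    with True show ?thesis by (intro exI[of _ "\<bar>x\<bar>"]) (auto simp: factors_ge_def)
  qed
next
  case False
  have "(\<lambda>k. \<bar>q\<bar> ^ k) \<longlonglongrightarrow> 0"
    using assms(1) by (intro LIMSEQ_power_zero) simp
  then have "\<forall>\<^sub>F k in sequentially. \<bar>q\<bar> ^ k < \<bar>y\<bar> / (\<bar>x\<bar> + 1)"
    using False by (intro order_tendstoD) (auto intro!: divide_pos_pos)
  then obtain N where N: "\<And>k. k \<ge> N \<Longrightarrow> \<bar>q\<bar> ^ k < \<bar>y\<bar> / (\<bar>x\<bar> + 1)"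
    by (auto simp: eventually_sequentially)
  have far: "1 \<le> \<bar>x + y / q ^ k\<bar>" if "k \<ge> N" for k
  proof -
    have "\<bar>x\<bar> + 1 < \<bar>y / q ^ k\<bar>"
      using N[OF that] assms(2) by (simp add: abs_divide power_abs field_simps)
    then show ?thesis by linarith
  qed
  define Z where "Z = insert 1 ((\<lambda>k. \<bar>x + y / q ^ k\<bar>) ` {..<N} - {0})"
  have Z: "finite Z" "Z \<noteq> {}" "1 \<in> Z" by (simp_all add: Z_def)
  show ?thesis
  proof (intro exI conjI)
    show "Min Z > 0" using Z by (subst Min_gr_iff) (auto simp: Z_def)
    show "factors_ge q (Min Z) e x y"
      unfolding factors_ge_def
    proof (intro allI impI ballI)
      fix n k assume nk: "n < 0" "e n \<noteq> 0" "k \<in> {1..nat (- n)}"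
      show "Min Z \<le> \<bar>x + y / q ^ k\<bar>"
      proof (cases "k \<ge> N")
        case True
        then show ?thesis using far Min_le[OF Z(1,3)] by fastforce
      next
        case False
        then show ?thesis using nz[OF nk] by (intro Min_le Z) (auto simp: Z_def)
      qed
    qed
  qed
qed

lemma times_off_poles_exists:
  assumes "\<bar>q\<bar> < 1" "q \<noteq> 0" "(x, t) \<in> wave_domain q c e"
  shows "\<exists>\<delta>>0. t \<in> times_off_poles q c e \<delta> x"
proof -
  obtain \<delta> where "\<delta> > 0" "factors_ge q \<delta> e x (c * t)"
    using factors_ge_exists[OF assms(1,2), of e x "c * t"] assms(3) by (auto simp: mem_wave_domain_iff)
  moreover obtain \<epsilon> where "\<epsilon> > 0" "factors_ge q \<epsilon> e x (- (c * t))"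
    using factors_ge_exists[OF assms(1,2), of e x "- (c * t)"] assms(3) by (auto simp: mem_wave_domain_iff)
  ultimately have "min \<delta> \<epsilon> > 0" "t \<in> times_off_poles q c e (min \<delta> \<epsilon>) x"
    by (auto simp: mem_times_off_poles_iff intro: factors_ge_mono)
  then show ?thesis by blast
qed

text \<open>
  Each differentiation lengthens the denominators by one factor, and at \<open>(x, t)\<close> the new last
  factor is the old last factor at \<open>(x, t / q)\<close>.
\<close>

lemma wave_domain_deriv:
  assumes "q \<noteq> 0" "(x, t) \<in> wave_domain q c e" "(x, t / q) \<in> wave_domain q c e"
  shows "(x, t) \<in> wave_domain q c (deriv_coeffs q e)"
  unfolding mem_wave_domain_iff
proof (intro allI impI ballI)
  fix n k assume n: "n < 0" "deriv_coeffs q e n \<noteq> 0" and k: "k \<in> {1..nat (- n)}"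
  then have "n + 1 \<noteq> 0" and e: "e (n + 1) \<noteq> 0"
    by (auto simp: deriv_coeffs_def q_number_def)
  then have n1: "n + 1 < 0" using n by simp
  show "x + c * t / q ^ k \<noteq> 0 \<and> x - c * t / q ^ k \<noteq> 0"
  proof (cases "k = 1")
    case True
    then show ?thesis
      using assms(2) n1 e unfolding mem_wave_domain_iff by fastforce
  next
    case False
    then have "k - 1 \<in> {1..nat (- (n + 1))}" and k1: "k = Suc (k - 1)" using k by auto
    then have "x + c * (t / q) / q ^ (k - 1) \<noteq> 0 \<and> x - c * (t / q) / q ^ (k - 1) \<noteq> 0"
      using assms(3) n1 e unfolding mem_wave_domain_iff by blast
    then show ?thesis by (subst (1 2) k1) simp
  qed
qed

section \<open>The Jackson integral as a \<open>q\<close>-antiderivative\<close>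

text \<open>
  The coefficients of the \<open>q\<close>-antiderivative of \<open>g\<close> that vanishes at \<open>0\<close>.  The constant
  coefficient is \<open>b (-1) / 0 = 0\<close>.
\<close>

definition jackson_coeffs :: "real \<Rightarrow> (int \<Rightarrow> real) \<Rightarrow> int \<Rightarrow> real" where
  "jackson_coeffs q b n = b (n - 1) / q_number q n"

lemma deriv_jackson_coeffs:
  assumes "q \<noteq> 0" "\<bar>q\<bar> < 1" "b (-1) = 0"
  shows "deriv_coeffs q (jackson_coeffs q b) = b"
proof
  fix n
  show "deriv_coeffs q (jackson_coeffs q b) n = b n"
    using assms q_number_nonzero[OF assms(1,2), of "n + 1"]
    by (cases "n = -1") (auto simp: deriv_coeffs_def jackson_coeffs_def q_number_def)
qed

lemma abs_laurent_jackson_coeffs: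
  assumes "\<bar>q\<bar> < 1" "abs_laurent b" "\<And>n. n < 0 \<Longrightarrow> b n = 0"
  shows "abs_laurent (jackson_coeffs q b)"
proof (rule abs_laurent_mult_le)
  show "abs_laurent (\<lambda>n. b (n + (- 1)))"
    by (rule abs_laurent_shift[OF assms(2)])
  show "\<bar>jackson_coeffs q b n\<bar> \<le> \<bar>q - 1\<bar> / (1 - \<bar>q\<bar>) * \<bar>b (n + (- 1))\<bar>" for n
  proof (cases "n \<ge> 1")
    case True
    define m where "m = nat n"
    have n: "n = int m" and m: "m \<ge> 1" using True by (simp_all add: m_def)
    have "\<bar>q ^ m\<bar> \<le> \<bar>q\<bar> ^ 1"
      unfolding power_abs using assms(1) m by (intro power_decreasing) auto
    then have "1 - \<bar>q\<bar> \<le> \<bar>q powi n - 1\<bar>"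
      unfolding n by simp
    then have "\<bar>q - 1\<bar> / \<bar>q powi n - 1\<bar> \<le> \<bar>q - 1\<bar> / (1 - \<bar>q\<bar>)"
      using assms(1) by (intro divide_left_mono) auto
    then have "\<bar>b (n - 1)\<bar> * (\<bar>q - 1\<bar> / \<bar>q powi n - 1\<bar>) \<le> \<bar>b (n - 1)\<bar> * (\<bar>q - 1\<bar> / (1 - \<bar>q\<bar>))"
      by (rule mult_left_mono) simp
    then show ?thesis
      by (simp add: jackson_coeffs_def q_number_def abs_mult mult.commute)
  next
    case False
    then show ?thesis using assms(1,3) by (simp add: jackson_coeffs_def)
  qed
qed

lemma abs_laurent_jackson_term:
  assumes "abs_laurent b" "q \<noteq> 0"
  shows "abs_laurent (jackson_term q b j)"
  using abs_laurent_shift[OF abs_laurent_scale[OF assms(1), of "q ^ j"], of "- 1"] assms(2)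
  by (simp add: jackson_term_def times_x_coeffs_def)

text \<open>
  With \<open>G\<close> the \<open>q\<close>-antiderivative of \<open>g\<close>, this says that \<open>(1 - q) q\<^sup>j x g(q\<^sup>j x)\<close> is the
  difference \<open>G(q\<^sup>j x) - G(q\<^sup>j\<^sup>+\<^sup>1 x)\<close>.
\<close>

lemma jackson_term_telescope:
  assumes "q \<noteq> 0" "\<bar>q\<bar> < 1" "b (-1) = 0"
  shows "(1 - q) * q ^ j * jackson_term q b j n
       = scale_coeffs (q ^ j) (jackson_coeffs q b) n - scale_coeffs (q ^ Suc j) (jackson_coeffs q b) n"
proof (cases "n = 0")
  case True
  then show ?thesis
    using assms by (simp add: jackson_term_def times_x_coeffs_def scale_coeffs_def)
next
  case False
  have B: "jackson_coeffs q b n * (1 - q powi n) = (1 - q) * b (n - 1)"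
    using q_number_nonzero[OF assms(1,2) False] assms(2)
    by (auto simp: jackson_coeffs_def q_number_def field_simps)
  have "scale_coeffs (q ^ j) (jackson_coeffs q b) n - scale_coeffs (q ^ Suc j) (jackson_coeffs q b) n
      = (jackson_coeffs q b n * (1 - q powi n)) * (q ^ j) powi n"
    unfolding scale_coeffs_def power_Suc power_int_mult_distrib by (simp add: algebra_simps)
  also have "\<dots> = (1 - q) * q ^ j * (b (n - 1) * (q ^ j) powi (n - 1))"
    unfolding B using assms(1) by (simp add: power_int_diff)
  finally show ?thesis
    by (simp add: jackson_term_def times_x_coeffs_def scale_coeffs_def)
qed

text \<open>
  The fundamental theorem for the Jackson integral.  The sum over \<open>j\<close> telescopes, and the
  waves of \<open>G(q\<^sup>j x)\<close> tend to \<open>0\<close> by dominated convergence because \<open>G\<close> has no constant term.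
\<close>

lemma jackson_sums:
  assumes "q \<noteq> 0" "\<bar>q\<bar> < 1" "abs_laurent b" and neg: "\<And>n. n < 0 \<Longrightarrow> b n = 0"
  shows "(\<lambda>j. (1 - q) * (q ^ j * q_wave q (jackson_term q b j) x y)) sums q_wave q (jackson_coeffs q b) x y"
proof -
  let ?B = "jackson_coeffs q b"
  let ?V = "\<lambda>j. q_wave q (scale_coeffs (q ^ j) ?B) x y"
  have B0: "?B n = 0" if "n \<le> 0" for n
    using that neg by (simp add: jackson_coeffs_def)
  have neg1: "b (-1) = 0" by (simp add: neg)
  have F: "factors_ge q 1 (scale_coeffs s ?B) x y" for s
    by (rule factors_ge_trivial) (simp add: scale_coeffs_def B0)
  have B: "abs_laurent ?B"
    by (rule abs_laurent_jackson_coeffs[OF assms(2,3) neg])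
  have S: "(\<lambda>n. scale_coeffs (q ^ j) ?B n * q_binom q x y n) summable_on UNIV" for j
    using assms F by (intro summable_on_wave[of _ q 1] abs_laurent_scale B) auto
  have S1: "(\<lambda>n. ?B n * q_binom q x y n) summable_on UNIV"
    using S[of 0] by (simp add: scale_coeffs_def)
  have step: "?V j - ?V (Suc j) = (1 - q) * (q ^ j * q_wave q (jackson_term q b j) x y)" for j
  proof -
    have "?V j - ?V (Suc j) = (\<Sum>\<^sub>\<infinity>n. scale_coeffs (q ^ j) ?B n * q_binom q x y n
                                  - scale_coeffs (q ^ Suc j) ?B n * q_binom q x y n)"
      unfolding q_wave_def by (rule infsum_real_diff[OF S S, symmetric])
    also have "\<dots> = q_wave q (\<lambda>n. (1 - q) * q ^ j * jackson_term q b j n) x y"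
      unfolding q_wave_def left_diff_distrib[symmetric]
      using jackson_term_telescope[of q b j, OF assms(1,2) neg1] by simp
    finally show ?thesis
      by (simp only: q_wave_cmult mult.assoc)
  qed
  have "?V \<longlonglongrightarrow> (\<Sum>\<^sub>\<infinity>n::int. 0)"
    unfolding q_wave_def
  proof (rule tendsto_infsum_dominated)
    show "(\<lambda>n. norm (?B n * q_binom q x y n)) summable_on UNIV"
      by (rule iffD1[OF summable_on_iff_abs_summable_on_real S1])
    have pw: "?B n = 0 \<or> \<bar>(q ^ j) powi n\<bar> \<le> \<bar>q\<bar> ^ j" for n j
    proof (cases "n \<ge> 1")
      case True
      define m where "m = nat n"
      have n: "n = int m" and m: "m \<ge> 1" using True by (simp_all add: m_def)
      have "(\<bar>q\<bar> ^ j) ^ m \<le> (\<bar>q\<bar> ^ j) ^ 1"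
        using assms(2) m by (intro power_decreasing power_le_one) auto
      then show ?thesis by (simp add: n power_abs)
    qed (use B0 in auto)
    have le: "\<bar>scale_coeffs (q ^ j) ?B n * q_binom q x y n\<bar> \<le> \<bar>q\<bar> ^ j * norm (?B n * q_binom q x y n)"
      for n j
    proof -
      have "\<bar>scale_coeffs (q ^ j) ?B n * q_binom q x y n\<bar>
          = \<bar>(q ^ j) powi n\<bar> * norm (?B n * q_binom q x y n)"
        by (simp add: scale_coeffs_def abs_mult)
      also have "\<dots> \<le> \<bar>q\<bar> ^ j * norm (?B n * q_binom q x y n)"
        using pw[of n j] by (auto intro: mult_right_mono)
      finally show ?thesis .
    qed
    have "\<bar>q\<bar> ^ j * norm (?B n * q_binom q x y n) \<le> norm (?B n * q_binom q x y n)" for n j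
      using assms(2) by (intro mult_left_le_one_le power_le_one) auto
    with le show "\<forall>\<^sub>F j in sequentially. \<forall>n. \<bar>scale_coeffs (q ^ j) ?B n * q_binom q x y n\<bar>
                     \<le> norm (?B n * q_binom q x y n)"
      by (intro always_eventually allI) (meson order_trans)
    show "(\<lambda>j. scale_coeffs (q ^ j) ?B n * q_binom q x y n) \<longlonglongrightarrow> 0" for n
    proof (rule Lim_null_comparison)
      show "\<forall>\<^sub>F j in sequentially. norm (scale_coeffs (q ^ j) ?B n * q_binom q x y n)
              \<le> \<bar>q\<bar> ^ j * norm (?B n * q_binom q x y n)"
        using le by (intro always_eventually allI) simp
      show "(\<lambda>j. \<bar>q\<bar> ^ j * norm (?B n * q_binom q x y n)) \<longlonglongrightarrow> 0"
        using assms(2) by (intro tendsto_mult_left_zero LIMSEQ_power_zero) simp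
    qed
  qed
  then have "?V \<longlonglongrightarrow> 0" by simp
  from telescope_sums'[OF this] show ?thesis
    unfolding step by (simp add: scale_coeffs_def)
qed

lemma jackson_to_eq_wave:
  assumes "q \<noteq> 0" "\<bar>q\<bar> < 1" "abs_laurent b" "\<And>n. n < 0 \<Longrightarrow> b n = 0"
  shows "summable (\<lambda>j. q ^ j * q_wave q (jackson_term q b j) x y)"
    and "jackson_to q b x y = q_wave q (jackson_coeffs q b) x y"
proof -
  note S = jackson_sums[OF assms]
  have "1 - q \<noteq> 0" using assms(2) by auto
  then show sm: "summable (\<lambda>j. q ^ j * q_wave q (jackson_term q b j) x y)"
    using sums_summable[OF S] by (simp only: summable_cmult_iff) auto
  show "jackson_to q b x y = q_wave q (jackson_coeffs q b) x y"
    using sums_unique[OF S] suminf_mult[OF sm] by (simp add: jackson_to_def)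
qed

text \<open>
  For \<open>n < 0\<close> the terms \<open>q\<^sup>j (q\<^sup>j)\<^sup>n\<close> have modulus at least \<open>1\<close>.
\<close>

lemma jackson_convergent_no_principal_part:
  assumes "q \<noteq> 0" "\<bar>q\<bar> < 1" "jackson_convergent q b" "n < 0"
  shows "b n = 0"
proof (rule ccontr)
  assume "b n \<noteq> 0"
  then have "summable (\<lambda>j. q ^ j * (q ^ j * 1) powi n)"
    using assms(3) unfolding jackson_convergent_def by (metis one_neq_zero)
  from tendsto_rabs[OF summable_LIMSEQ_zero[OF this]]
  have lim: "(\<lambda>j. \<bar>q ^ j * (q ^ j * 1) powi n\<bar>) \<longlonglongrightarrow> 0" by simp
  have "1 \<le> \<bar>q ^ j * (q ^ j * 1) powi n\<bar>" for j
  proof -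
    define m where "m = nat (- n - 1)"
    have n: "n + 1 = - int m" using assms(4) by (simp add: m_def)
    have "q ^ j * (q ^ j * 1) powi n = (q ^ j) powi (n + 1)"
      using assms(1) by (simp add: power_int_add)
    also have "\<bar>\<dots>\<bar> = inverse ((\<bar>q\<bar> ^ j) ^ m)"
      unfolding n by (simp add: power_int_minus power_abs)
    also have "\<dots> \<ge> 1"
      using assms(1,2) by (intro one_le_inverse power_le_one) auto
    finally show ?thesis .
  qed
  then have "1 \<le> (0::real)"
    by (intro tendsto_lowerbound[OF lim] always_eventually) auto
  then show False by simp
qed

text \<open>
  The identity theorem for power series: once the lower coefficients vanish, dividing by
  \<open>x\<^sup>m\<close> and letting \<open>x\<close> tend to \<open>0\<close> isolates the coefficient with index \<open>m\<close>.
\<close>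

lemma has_laurent_zero_unique:
  assumes g: "has_laurent g b" and neg: "\<And>n. n < 0 \<Longrightarrow> b n = 0" and zero: "\<And>x. g x = 0"
  shows "b n = 0"
proof -
  have sums: "(\<lambda>k. b (int k) * x ^ k) sums 0" for x
  proof (rule has_sum_imp_sums)
    have "((\<lambda>n. b n * x powi n) has_sum 0) UNIV"
      using g neg zero unfolding has_laurent_def by metis
    then have "((\<lambda>n. b n * x powi n) has_sum 0) (range int)"
    proof (subst has_sum_cong_neutral[where T = UNIV and g = "\<lambda>n. b n * x powi n"])
      show "b n * x powi n = 0" if "n \<in> UNIV - range int" for n
      proof -
        have "n < 0" using that by (metis DiffD2 nonneg_int_cases not_le rangeI)
        then show ?thesis by (simp add: neg)
      qed
    qed auto
    then show "((\<lambda>k. b (int k) * x ^ k) has_sum 0) UNIV"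
      by (simp add: has_sum_reindex o_def)
  qed
  have "b (int m) = 0" for m
  proof (induction m rule: less_induct)
    case (less m)
    have "((\<lambda>_. 0) \<longlongrightarrow> b (int (0 + m))) (at (0::real))"
    proof (rule powser_limit_0_strong[OF zero_less_one, of "\<lambda>k. b (int (k + m))"])
      fix x :: real assume "x \<noteq> 0"
      have "(\<lambda>k. b (int (k + m)) * x ^ (k + m)) sums 0"
        using sums[of x] less by (subst sums_iff_shift) simp
      from sums_mult2[OF this, of "inverse (x ^ m)"] \<open>x \<noteq> 0\<close>
      show "(\<lambda>k. b (int (k + m)) * x ^ k) sums 0"
        by (simp add: power_add mult.assoc)
    qed
    then show ?case
      by (simp add: tendsto_const_iff)
  qed
  then show ?thesis
    using neg by (metis nonneg_int_cases not_le)
qed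

section \<open>The initial value problem\<close>

text \<open>
  Away from \<open>x = 0\<close> both sides are \<open>c\<^sup>2\<close> times the same D'Alembert combination \<open>w\<close> of second
  derivatives.  At \<open>x = 0\<close> the second derivative in \<open>x\<close> is a limit of values of \<open>w\<close> at nearby
  points, and \<open>w\<close> is continuous in \<open>x\<close> there.
\<close>

lemma dalembert_satisfies_q_wave_equation:
  assumes q: "q \<noteq> 0" "\<bar>q\<bar> < 1" and c: "c \<noteq> 0" and t: "t \<noteq> 0"
    and a: "abs_laurent a" and e: "abs_laurent e" and neg: "\<And>n. n < 0 \<Longrightarrow> e n = 0"
    and dom: "(x, t) \<in> wave_domain q c a" "(x, t / q) \<in> wave_domain q c a"
      "(x, t / q\<^sup>2) \<in> wave_domain q c a"
  shows "(Dt (1 / q) ^^ 2) (dalembert q c a e) x t = c\<^sup>2 * (Dx q ^^ 2) (dalembert q c a e) x t"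
proof -
  let ?D = "deriv_coeffs q"
  let ?u = "dalembert q c a e" and ?w = "dalembert q c (?D (?D a)) (?D (?D e))"
  have "(x, t / q) \<in> wave_domain q c (?D a)"
    by (rule wave_domain_deriv[OF q(1) dom(2)]) (use dom(3) in \<open>simp add: power2_eq_square\<close>)
  then have "(x, t) \<in> wave_domain q c (?D (?D a))"
    by (rule wave_domain_deriv[OF q(1) wave_domain_deriv[OF q(1) dom(1,2)]])
  then obtain \<delta> where \<delta>: "\<delta> > 0" and offa: "t \<in> times_off_poles q c (?D (?D a)) \<delta> x"
    using times_off_poles_exists[OF q(2,1)] by blast
  have offe: "s \<in> times_off_poles q c (?D (?D e)) \<epsilon> z" for s \<epsilon> z
    unfolding mem_times_off_poles_iff
    by (intro conjI factors_ge_trivial deriv_coeffs_no_principal_part neg)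
  have t2: "(Dt (1 / q) ^^ 2) ?u x t = c\<^sup>2 * ?w x t"
    using Dt_Dt_dalembert[OF q c \<delta> t a e offa offe] by (simp add: numeral_2_eq_2)
  have x2: "(Dx q ^^ 2) ?u x t = q_deriv q (\<lambda>y. Dx q ?u y t) x"
    by (simp add: numeral_2_eq_2 Dx_def)
  have "q_deriv q (\<lambda>y. Dx q ?u y t) x = ?w x t"
  proof (cases "x = 0")
    case False
    then show ?thesis
      using q_quotient_Dx_dalembert[OF q \<delta> False a e offa offe] by (simp add: q_deriv_def)
  next
    case True
    define r where "r = \<bar>c * t\<bar> / 2"
    have r: "r > 0" using c t by (simp add: r_def)
    have near: "t \<in> times_off_poles q c h r y" if "\<bar>y\<bar> \<le> r" for h y
      using factors_ge_near_axis[of q y "c * t" h] factors_ge_near_axis[of q y "- (c * t)" h] q that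
      by (simp add: mem_times_off_poles_iff r_def)
    have ball: "\<forall>\<^sub>F y in at 0. y \<noteq> 0 \<and> \<bar>y\<bar> \<le> r"
      using r unfolding eventually_at by (intro exI[of _ r]) (auto simp: dist_real_def)
    have "((\<lambda>y. ?w y t) \<longlongrightarrow> ?w 0 t) (at 0)"
      using r q ball
      by (intro tendsto_dalembert[where \<delta> = r] abs_laurent_deriv a e tendsto_ident_at tendsto_const near)
         (auto elim: eventually_mono intro: near)
    moreover have "\<forall>\<^sub>F y in at 0. ?w y t = q_quotient q (\<lambda>y. Dx q ?u y t) y"
      using ball
    proof eventually_elim
      case (elim y)
      then show ?case
        by (intro q_quotient_Dx_dalembert[OF q r _ a e, symmetric] near) auto
    qed
    ultimately have "(q_quotient q (\<lambda>y. Dx q ?u y t) \<longlongrightarrow> ?w 0 t) (at 0)"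
      by (rule Lim_transform_eventually)
    then show ?thesis
      using True by (simp add: q_deriv_def tendsto_Lim)
  qed
  then show ?thesis
    unfolding t2 x2 by simp
qed

lemma wave_domain_initial:
  assumes "(x, 0) \<in> wave_domain q c e"
  shows "x \<noteq> 0 \<or> (\<forall>n<0. e n = 0)"
proof (rule ccontr)
  assume "\<not> ?thesis"
  then obtain n where n: "x = 0" "n < 0" "e n \<noteq> 0" by blast
  from n(2) have "1 \<in> {1..nat (- n)}" by auto
  with n assms show False unfolding mem_wave_domain_iff by fastforce
qed

text \<open>
  The derivative has one factor more than the series itself.  If the negative powers are
  unbounded, it is among the factors already kept away from \<open>0\<close>.  Otherwise only
  finitely many factors occur; they tend to \<open>x\<close>, which is not \<open>0\<close> if there are any.
\<close>

lemma eventually_times_off_poles_deriv: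
  assumes q: "q \<noteq> 0" "\<bar>q\<bar> < 1" and "\<delta> > 0" and dom: "(x, 0) \<in> wave_domain q c e"
  obtains \<epsilon> where "\<epsilon> > 0" "0 \<in> times_off_poles q c (deriv_coeffs q e) \<epsilon> x"
    "\<forall>\<^sub>F t in at 0 within times_off_poles q c e \<delta> x. t \<in> times_off_poles q c (deriv_coeffs q e) \<epsilon> x"
proof (cases "\<forall>n<0. e n = 0")
  case True
  then have "t \<in> times_off_poles q c (deriv_coeffs q e) 1 x" for t
    unfolding mem_times_off_poles_iff
    by (intro conjI factors_ge_trivial deriv_coeffs_no_principal_part) auto
  then show ?thesis using that[of 1] by simp
next
  case False
  then have x: "x \<noteq> 0" using wave_domain_initial[OF dom] by blast
  define \<epsilon> where "\<epsilon> = min \<delta> (\<bar>x\<bar> / 2)"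
  have \<epsilon>: "\<epsilon> > 0" "\<epsilon> \<le> \<delta>" "\<epsilon> \<le> \<bar>x\<bar> / 2" using x assms by (auto simp: \<epsilon>_def)
  let ?T = "times_off_poles q c e \<delta> x"
  have ev: "\<forall>\<^sub>F t in at 0 within ?T. t \<in> times_off_poles q c (deriv_coeffs q e) \<epsilon> x"
  proof (cases "\<exists>N. \<forall>n<0. e n \<noteq> 0 \<longrightarrow> nat (1 - n) \<le> N")
    case True
    then obtain N where N: "\<And>n. n < 0 \<Longrightarrow> e n \<noteq> 0 \<Longrightarrow> nat (1 - n) \<le> N" by blast
    have "((\<lambda>t. c * t / q ^ N) \<longlongrightarrow> c * 0 / q ^ N) (at 0 within ?T)"
      using q(1) by (intro tendsto_intros) auto
    then have "\<forall>\<^sub>F t in at 0 within ?T. \<bar>c * t / q ^ N\<bar> < \<bar>x\<bar> / 2"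
      using x by (intro order_tendstoD(2)[OF tendsto_rabs]) auto
    then show ?thesis
    proof eventually_elim
      case (elim t)
      have small: "\<bar>c * t / q ^ k\<bar> \<le> \<bar>x\<bar> / 2" if "k \<le> N" for k
      proof -
        have "\<bar>q\<bar> ^ N \<le> \<bar>q\<bar> ^ k" using q that by (intro power_decreasing) auto
        then have "\<bar>c * t / q ^ k\<bar> \<le> \<bar>c * t / q ^ N\<bar>"
          using q(1) unfolding abs_divide power_abs by (intro divide_left_mono mult_pos_pos) auto
        with elim show ?thesis by linarith
      qed
      have far: "\<epsilon> \<le> \<bar>x + y / q ^ k\<bar>"
        if "n < 0" "e n \<noteq> 0" "k \<in> {1..nat (1 - n)}" "y = c * t \<or> y = - (c * t)" for n k y
      proof -
        have "k \<le> N" using N[OF that(1,2)] that(3) by simp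
        from small[OF this] that(4) have "\<bar>y / q ^ k\<bar> \<le> \<bar>x\<bar> / 2" by auto
        then show ?thesis using \<epsilon>(3) by linarith
      qed
      show ?case
        unfolding mem_times_off_poles_iff by (intro conjI factors_ge_derivI; rule far; (assumption | simp))
    qed
  next
    case False
    have "t \<in> times_off_poles q c (deriv_coeffs q e) \<epsilon> x" if t: "t \<in> ?T" for t
    proof -
      have far: "\<epsilon> \<le> \<bar>x + y / q ^ k\<bar>"
        if "y = c * t \<or> y = - (c * t)" "k \<ge> 1" for k y
      proof -
        obtain n where n: "n < 0" "e n \<noteq> 0" "\<not> nat (1 - n) \<le> k"
          using False by blast
        then have "k \<in> {1..nat (- n)}" using that by auto
        then have "\<delta> \<le> \<bar>x + y / q ^ k\<bar>"
          using t that(1) n unfolding mem_times_off_poles_iff factors_ge_def by blast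
        then show ?thesis using \<epsilon>(2) by linarith
      qed
      show ?thesis
        unfolding mem_times_off_poles_iff by (intro conjI factors_ge_derivI; rule far) auto
    qed
    then show ?thesis by (auto simp: eventually_at_filter)
  qed
  have "0 \<in> times_off_poles q c (deriv_coeffs q e) \<epsilon> x"
    using \<epsilon>(1,3) by (simp add: mem_times_off_poles_iff factors_ge_def)
  with ev show ?thesis using that \<epsilon>(1) by blast
qed

text \<open>
  At \<open>t = 0\<close> the two waves of the derivative of \<open>f\<close> cancel and those of the derivative of the
  antiderivative coincide.
\<close>

lemma tendsto_Dt_dalembert:
  assumes q: "q \<noteq> 0" "\<bar>q\<bar> < 1" and c: "c \<noteq> 0" and \<delta>: "\<delta> > 0"
    and a: "abs_laurent a" and e: "abs_laurent e" and neg: "\<And>n. n < 0 \<Longrightarrow> e n = 0"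
    and dom: "(x, 0) \<in> wave_domain q c a"
  shows "((\<lambda>t. Dt (1 / q) (dalembert q c a e) x t) \<longlongrightarrow> q_wave q (deriv_coeffs q e) x 0)
           (at 0 within times_off_poles q c a \<delta> x)"
proof -
  let ?D = "deriv_coeffs q" and ?F = "at 0 within times_off_poles q c a \<delta> x"
  let ?a' = "\<lambda>n. c\<^sup>2 * ?D a n"
  obtain \<epsilon> where \<epsilon>: "\<epsilon> > 0" and off0: "0 \<in> times_off_poles q c (?D a) \<epsilon> x"
    and ev: "\<forall>\<^sub>F t in ?F. t \<in> times_off_poles q c (?D a) \<epsilon> x"
    using eventually_times_off_poles_deriv[OF q \<delta> dom] .
  have offe: "s \<in> times_off_poles q c (?D e) \<epsilon> x" for s
    unfolding mem_times_off_poles_iff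
    by (intro conjI factors_ge_trivial deriv_coeffs_no_principal_part neg)
  have off_c: "s \<in> times_off_poles q c ?a' \<epsilon> x" if "s \<in> times_off_poles q c (?D a) \<epsilon> x" for s
    using that c by (simp add: mem_times_off_poles_iff factors_ge_def)
  have a': "abs_laurent ?a'"
    using abs_laurent_deriv[OF a q(1)]
    by (rule abs_laurent_mult_le[where C = "c\<^sup>2"]) (simp add: abs_mult)
  have "((\<lambda>t. dalembert q c (?D e) ?a' x t) \<longlongrightarrow> dalembert q c (?D e) ?a' x 0) ?F"
  proof (rule tendsto_dalembert[where \<delta> = \<epsilon>])
    show "\<forall>\<^sub>F t in ?F. t \<in> times_off_poles q c ?a' \<epsilon> x"
      using ev by eventually_elim (rule off_c)
  qed (use q \<epsilon> off0 offe a' e in \<open>auto intro: abs_laurent_deriv off_c tendsto_ident_at\<close>)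
  moreover have "\<forall>\<^sub>F t in ?F. dalembert q c (?D e) ?a' x t = Dt (1 / q) (dalembert q c a e) x t"
  proof -
    have "\<forall>\<^sub>F t in ?F. t \<noteq> 0" by (simp add: eventually_at_filter)
    with ev show ?thesis
      by eventually_elim (simp add: Dt_dalembert[OF q c \<epsilon> _ a e _ offe])
  qed
  ultimately have "((\<lambda>t. Dt (1 / q) (dalembert q c a e) x t) \<longlongrightarrow> dalembert q c (?D e) ?a' x 0) ?F"
    by (rule Lim_transform_eventually)
  then show ?thesis by (simp add: dalembert_def)
qed

theorem mainTheorem4:
  fixes q c :: real
    and f g :: "real \<Rightarrow> real"
    and a b :: "int \<Rightarrow> real"
    and u :: "real \<Rightarrow> real \<Rightarrow> real"
  assumes "q \<noteq> 0" and "\<bar>q\<bar> < 1" and "c \<noteq> 0"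
    and "has_laurent f a"
    and "has_laurent g b"
    and "jackson_convergent q b"
    and "u = (\<lambda>x t. (q_wave q a x (c * t) + q_wave q a x (- (c * t))) / 2
                  + 1 / (2 * c) * (jackson_to q b x (c * t) - jackson_to q b x (- (c * t))))"
  shows "(\<forall>(x, t) \<in> wave_domain q c a. \<forall>y \<in> {c * t, - (c * t)}.
            (\<lambda>n. a n * q_binom q x y n) summable_on UNIV
          \<and> (\<forall>j. (\<lambda>n. jackson_term q b j n * q_binom q x y n) summable_on UNIV)
          \<and> summable (\<lambda>j. q ^ j * q_wave q (jackson_term q b j) x y))
    \<and> (\<forall>x t. t \<noteq> 0
          \<and> {(x, t), (x, t / q), (x, t / q\<^sup>2), (q * x, t), (q\<^sup>2 * x, t)} \<subseteq> wave_domain q c a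
        \<longrightarrow> (Dt (1 / q) ^^ 2) u x t - c\<^sup>2 * (Dx q ^^ 2) u x t = 0)
    \<and> (\<forall>x. (x, 0) \<in> wave_domain q c a \<longrightarrow> u x 0 = f x)
    \<and> (\<forall>x. (x, 0) \<in> wave_domain q c a \<longrightarrow>
          (\<forall>\<delta>>0. ((\<lambda>t. Dt (1 / q) u x t) \<longlongrightarrow> g x) (at 0 within times_off_poles q c a \<delta> x)))
    \<and> ((\<forall>x. g x = 0) \<longrightarrow>
          (\<forall>x t. u x t = 1 / 2 * (q_wave q a x (c * t) + q_wave q a x (- (c * t)))))"
proof -
  note q = assms(1,2) and c = assms(3)
  have neg: "b n = 0" if "n < 0" for n
    by (rule jackson_convergent_no_principal_part[OF q assms(6) that])
  have a: "abs_laurent a" and b: "abs_laurent b"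
    using assms(4,5) by (auto intro: has_laurent_imp_abs_laurent)
  define B where "B = jackson_coeffs q b"
  have B: "abs_laurent B"
    unfolding B_def by (rule abs_laurent_jackson_coeffs[OF q(2) b neg])
  have Bneg: "B n = 0" if "n < 0" for n
    using that neg by (simp add: B_def jackson_coeffs_def)
  have DB: "deriv_coeffs q B = b"
    unfolding B_def by (rule deriv_jackson_coeffs[OF q]) (simp add: neg)
  have J: "jackson_to q b x y = q_wave q B x y" for x y
    unfolding B_def by (rule jackson_to_eq_wave(2)[OF q b neg])
  have u: "u = dalembert q c a B"
    by (simp add: fun_eq_iff assms(7) dalembert_def J)
  have at_zero: "q_wave q h x 0 = F x"
    if "has_laurent F h" "x \<noteq> 0 \<or> (\<forall>n<0. h n = 0)" for F h x
    using that unfolding has_laurent_def q_wave_zero_right by (metis infsumI)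
  have "(\<lambda>n. a n * q_binom q x y n) summable_on UNIV
      \<and> (\<forall>j. (\<lambda>n. jackson_term q b j n * q_binom q x y n) summable_on UNIV)
      \<and> summable (\<lambda>j. q ^ j * q_wave q (jackson_term q b j) x y)"
    if xt: "(x, t) \<in> wave_domain q c a" and y: "y \<in> {c * t, - (c * t)}" for x t y
  proof (intro conjI allI)
    obtain \<delta> where "\<delta> > 0" "t \<in> times_off_poles q c a \<delta> x"
      using times_off_poles_exists[OF q(2,1) xt] by blast
    then show "(\<lambda>n. a n * q_binom q x y n) summable_on UNIV"
      using y q by (intro summable_on_wave[of a q \<delta>] a) (auto simp: mem_times_off_poles_iff)
    show "(\<lambda>n. jackson_term q b j n * q_binom q x y n) summable_on UNIV" for j
      using q neg
      by (intro summable_on_wave[of _ q 1] abs_laurent_jackson_term b factors_ge_trivial)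
         (auto simp: jackson_term_def times_x_coeffs_def scale_coeffs_def)
    show "summable (\<lambda>j. q ^ j * q_wave q (jackson_term q b j) x y)"
      by (rule jackson_to_eq_wave(1)[OF q b neg])
  qed
  moreover have "(Dt (1 / q) ^^ 2) u x t - c\<^sup>2 * (Dx q ^^ 2) u x t = 0"
    if "t \<noteq> 0" "{(x, t), (x, t / q), (x, t / q\<^sup>2)} \<subseteq> wave_domain q c a" for x t
    using dalembert_satisfies_q_wave_equation[OF q c that(1) a B Bneg, of x] that(2) by (simp add: u)
  moreover have "u x 0 = f x" if "(x, 0) \<in> wave_domain q c a" for x
    using at_zero[OF assms(4) wave_domain_initial[OF that]] by (simp add: u dalembert_def)
  moreover have "((\<lambda>t. Dt (1 / q) u x t) \<longlongrightarrow> g x) (at 0 within times_off_poles q c a \<delta> x)"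
    if "(x, 0) \<in> wave_domain q c a" "\<delta> > 0" for x \<delta>
    using tendsto_Dt_dalembert[OF q c that(2) a B Bneg that(1)] at_zero[OF assms(5), of x] neg
    by (simp add: u DB)
  moreover have "u x t = 1 / 2 * (q_wave q a x (c * t) + q_wave q a x (- (c * t)))"
    if "\<forall>x. g x = 0" for x t
  proof -
    have "b n = 0" for n
      using has_laurent_zero_unique[OF assms(5) neg] that by blast
    then have "q_wave q B x y = 0" for y
      by (simp add: B_def jackson_coeffs_def q_wave_def)
    then show ?thesis by (simp add: u dalembert_def)
  qed
  ultimately show ?thesis by auto
qed

end
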